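(* Let $P$ be a finite poset with $|P|=n$, $K$ a field, and $S=K[\{x_p,y_p\}_{p\in P}]$. For $i\ge 0$ let $\mathbb{F}_i$ be the free $S$-module with basis the symbols $e(I,T)$, where $I\in\mathcal{J}(P)$, $T\subset P$, $I\cap T\subset M(I)$, $|I\cap T|=i$ and $|I|+|T|=n+i$ (equivalently $I\cup T=P$). Fix a total order on $P$ extending its partial order, and for $i>0$ define $\partial:\mathbb{F}_i\to\mathbb{F}_{i-1}$ by $$\partial(e(I,T))=\sum_{p\in I\cap T}(-1)^{\sigma(I\cap T,p)}\bigl(x_p\,e(I\setminus\{p\},T)-y_p\,e(I,T\setminus\{p\})\bigr),$$ where, for $Q\subset P$ and $p\in Q$, $\sigma(Q,p)=|\{q\in Q: q<p\}|$ with respect to the fixed total order. Then $(\mathbb{F},\partial)$ is a graded minimal free $S$-resolution of $H_P$.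
   Context: A poset ideal of a finite poset $P$ is a subset $I\subset P$ such that $x\in I$, $y\in P$, $y\le x$ imply $y\in I$ ($\emptyset$ and $P$ are poset ideals). $\mathcal{J}(P)$ is the set of all poset ideals of $P$, ordered by inclusion. For $I\in\mathcal{J}(P)$, $M(I)$ denotes the set of maximal elements of $I$. $S=K[\{x_p,y_p\}_{p\in P}]$ is a polynomial ring in $2n$ variables with $\deg x_p=\deg y_p=1$. For $I\in\mathcal{J}(P)$ set $u_I=\bigl(\prod_{p\in I}x_p\bigr)\bigl(\prod_{p\in P\setminus I}y_p\bigr)$, and let $H_P\subset S$ be the ideal generated by all $u_I$, $I\in\mathcal{J}(P)$. The basis elements $e(I,T)$ of $\mathbb{F}_i$ are placed in degree $n+i$. *)

theory Defs
  imports "HOL-Algebra.Ideal" "HOL-Algebra.Module" "HOL-Algebra.Generated_Groups" "HOL-Library.Poly_Mapping"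
begin

section \<open>Polynomial rings and graded modules\<close>

type_synonym ('v, 'k) mpoly = "('v \<Rightarrow>\<^sub>0 nat) \<Rightarrow>\<^sub>0 'k"

text \<open>The polynomial ring over the field \<^typ>\<open>'k\<close> whose set of variables is exactly \<open>V\<close>
  (and not the whole type \<^typ>\<open>'v\<close>).\<close>

definition poly_ring :: "'v set \<Rightarrow> ('v, 'k::field) mpoly ring" where
  "poly_ring V = \<lparr>carrier = {f. \<forall>m\<in>Poly_Mapping.keys f. Poly_Mapping.keys m \<subseteq> V},
     mult = (*), one = 1, zero = 0, add = (+)\<rparr>"

definition var :: "'v \<Rightarrow> ('v, 'k::field) mpoly" where
  "var v = Poly_Mapping.single (Poly_Mapping.single v 1) 1"

definition mon_degree :: "('v \<Rightarrow>\<^sub>0 nat) \<Rightarrow> nat" where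
  "mon_degree m = (\<Sum>v\<in>Poly_Mapping.keys m. Poly_Mapping.lookup m v)"

definition poly_component :: "'v set \<Rightarrow> nat \<Rightarrow> ('v, 'k::field) mpoly set" where
  "poly_component V d = {f \<in> carrier (poly_ring V). \<forall>m\<in>Poly_Mapping.keys f. mon_degree m = d}"

text \<open>In the following, a graded ring is given by a ring \<open>R\<close> together with its homogeneous
  components \<open>G d\<close>, and a graded \<open>R\<close>-module by a module \<open>M\<close> together with its homogeneous
  components \<open>N d\<close>.\<close>

definition graded_module ::
  "('r, 'x) ring_scheme \<Rightarrow> (nat \<Rightarrow> 'r set) \<Rightarrow> ('r, 'm, 'y) module_scheme \<Rightarrow> (nat \<Rightarrow> 'm set) \<Rightarrow> bool"
where
  "graded_module R G M N \<longleftrightarrow>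
     module R M \<and>
     (\<forall>d. subgroup (N d) (add_monoid M)) \<and>
     (\<forall>i j. \<forall>a\<in>G i. \<forall>x\<in>N j. a \<odot>\<^bsub>M\<^esub> x \<in> N (i + j)) \<and>
     (\<forall>x\<in>carrier M. \<exists>!c. (\<forall>d. c d \<in> N d) \<and> finite {d. c d \<noteq> \<zero>\<^bsub>M\<^esub>} \<and>
        x = (\<Oplus>\<^bsub>M\<^esub>d\<in>{d. c d \<noteq> \<zero>\<^bsub>M\<^esub>}. c d))"

definition module_homs ::
  "('r, 'x) ring_scheme \<Rightarrow> ('r, 'm, 'y) module_scheme \<Rightarrow> ('r, 'n, 'z) module_scheme \<Rightarrow> ('m \<Rightarrow> 'n) set"
where
  "module_homs R M M' = {f \<in> carrier M \<rightarrow> carrier M'.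
     (\<forall>x\<in>carrier M. \<forall>y\<in>carrier M. f (x \<oplus>\<^bsub>M\<^esub> y) = f x \<oplus>\<^bsub>M'\<^esub> f y) \<and>
     (\<forall>a\<in>carrier R. \<forall>x\<in>carrier M. f (a \<odot>\<^bsub>M\<^esub> x) = a \<odot>\<^bsub>M'\<^esub> f x)}"

definition graded_homs ::
  "('r, 'x) ring_scheme \<Rightarrow> ('r, 'm, 'y) module_scheme \<Rightarrow> (nat \<Rightarrow> 'm set) \<Rightarrow>
     ('r, 'n, 'z) module_scheme \<Rightarrow> (nat \<Rightarrow> 'n set) \<Rightarrow> ('m \<Rightarrow> 'n) set"
where
  "graded_homs R M N M' N' = {f \<in> module_homs R M M'. \<forall>d. f ` N d \<subseteq> N' d}"

text \<open>An ideal, viewed as a module. The fields \<open>mult\<close> and \<open>one\<close> of a module record are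
  irrelevant.\<close>

definition ideal_module :: "('r, 'x) ring_scheme \<Rightarrow> 'r set \<Rightarrow> ('r, 'r) module" where
  "ideal_module R H = \<lparr>carrier = H, mult = mult R, one = one R, zero = zero R, add = add R,
     smult = mult R\<rparr>"

text \<open>The free module with basis \<open>B\<close>: finite formal linear combinations of elements of \<open>B\<close>.
  The basis vector of \<open>b \<in> B\<close> is \<open>Poly_Mapping.single b 1\<close>.\<close>

definition free_module :: "('r::comm_ring_1, 'x) ring_scheme \<Rightarrow> 'b set \<Rightarrow> ('r, 'b \<Rightarrow>\<^sub>0 'r) module"
where
  "free_module R B = \<lparr>carrier = {v. Poly_Mapping.keys v \<subseteq> B \<and>
       (\<forall>b. Poly_Mapping.lookup v b \<in> carrier R)},
     mult = undefined, one = undefined, zero = 0, add = (+),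
     smult = (\<lambda>a. Poly_Mapping.map ((*) a))\<rparr>"

text \<open>Grading of the free module for which the basis vector of \<open>b\<close> has degree \<open>\<delta> b\<close>.\<close>

definition free_component ::
  "('r::comm_ring_1, 'x) ring_scheme \<Rightarrow> (nat \<Rightarrow> 'r set) \<Rightarrow> 'b set \<Rightarrow> ('b \<Rightarrow> nat) \<Rightarrow>
     nat \<Rightarrow> ('b \<Rightarrow>\<^sub>0 'r) set"
where
  "free_component R G B \<delta> d = {v \<in> carrier (free_module R B).
     \<forall>b\<in>Poly_Mapping.keys v. \<delta> b \<le> d \<and> Poly_Mapping.lookup v b \<in> G (d - \<delta> b)}"

text \<open>The linear map that sends the basis vector of \<open>b\<close> to \<open>g b\<close>.\<close>

definition linear_extension ::
  "('b \<Rightarrow> ('c \<Rightarrow>\<^sub>0 'r::comm_ring_1)) \<Rightarrow> ('b \<Rightarrow>\<^sub>0 'r) \<Rightarrow> ('c \<Rightarrow>\<^sub>0 'r)"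
where
  "linear_extension g v =
     (\<Sum>b\<in>Poly_Mapping.keys v. Poly_Mapping.map ((*) (Poly_Mapping.lookup v b)) (g b))"

definition irrelevant_ideal :: "('r, 'x) ring_scheme \<Rightarrow> (nat \<Rightarrow> 'r set) \<Rightarrow> 'r set" where
  "irrelevant_ideal R G = genideal R (\<Union>d\<in>{1..}. G d)"

definition ideal_times_module :: "'r set \<Rightarrow> ('r, 'm, 'y) module_scheme \<Rightarrow> 'm set" where
  "ideal_times_module A M = generate (add_monoid M) {a \<odot>\<^bsub>M\<^esub> x | a x. a \<in> A \<and> x \<in> carrier M}"

text \<open>The complex with free modules \<open>F i\<close> on the bases \<open>B i\<close> (where \<open>b \<in> B i\<close> has
  degree \<open>\<delta> i b\<close>) and differentials \<open>D i : F i \<rightarrow> F (i - 1)\<close>, \<open>i > 0\<close>, is a graded minimal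
  free resolution of the graded module \<open>(M, N)\<close>: for some augmentation \<open>\<epsilon>\<close> of degree 0, the sequence
  \<open>\<dots> \<rightarrow> F 1 \<rightarrow> F 0 \<rightarrow> M \<rightarrow> 0\<close> is exact, and \<open>D (F (i + 1)) \<subseteq> \<mm> F i\<close>. The value \<open>D 0\<close>
  is not used.\<close>

definition graded_minimal_free_resolution ::
  "('r::comm_ring_1, 'x) ring_scheme \<Rightarrow> (nat \<Rightarrow> 'r set) \<Rightarrow>
   (nat \<Rightarrow> 'b set) \<Rightarrow> (nat \<Rightarrow> 'b \<Rightarrow> nat) \<Rightarrow> (nat \<Rightarrow> ('b \<Rightarrow>\<^sub>0 'r) \<Rightarrow> ('b \<Rightarrow>\<^sub>0 'r)) \<Rightarrow>
   ('r, 'm, 'y) module_scheme \<Rightarrow> (nat \<Rightarrow> 'm set) \<Rightarrow> bool"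
where
  "graded_minimal_free_resolution R G B \<delta> D M N \<longleftrightarrow>
    (let F = (\<lambda>i. free_module R (B i)); FG = (\<lambda>i. free_component R G (B i) (\<delta> i)) in
      graded_module R G M N \<and>
      (\<forall>i. finite (B i)) \<and>
      (\<forall>i. D (Suc i) \<in> graded_homs R (F (Suc i)) (FG (Suc i)) (F i) (FG i)) \<and>
      (\<exists>\<epsilon> \<in> graded_homs R (F 0) (FG 0) M N.
         \<epsilon> ` carrier (F 0) = carrier M \<and>
         {v \<in> carrier (F 0). \<epsilon> v = \<zero>\<^bsub>M\<^esub>} = D 1 ` carrier (F 1)) \<and>
      (\<forall>i. {v \<in> carrier (F (Suc i)). D (Suc i) v = \<zero>\<^bsub>F i\<^esub>}
             = D (Suc (Suc i)) ` carrier (F (Suc (Suc i)))) \<and>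
      (\<forall>i. D (Suc i) ` carrier (F (Suc i)) \<subseteq> ideal_times_module (irrelevant_ideal R G) (F i)))"


section \<open>The ideal of a finite poset and its complex\<close>

text \<open>A poset is a set \<open>P\<close> with a relation \<open>r\<close>, where \<open>(p, q) \<in> r\<close> means \<open>p \<le> q\<close>.\<close>

definition poset_ideals :: "'p set \<Rightarrow> 'p rel \<Rightarrow> 'p set set" where
  "poset_ideals P r = {I. I \<subseteq> P \<and> (\<forall>x\<in>I. \<forall>y\<in>P. (y, x) \<in> r \<longrightarrow> y \<in> I)}"

definition maximal_elements :: "'p rel \<Rightarrow> 'p set \<Rightarrow> 'p set" where
  "maximal_elements r I = {p \<in> I. \<forall>q\<in>I. (p, q) \<in> r \<longrightarrow> q = p}"

datatype 'p xyvar = X 'p | Y 'p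

definition xy_vars :: "'p set \<Rightarrow> 'p xyvar set" where
  "xy_vars P = X ` P \<union> Y ` P"

definition u_monomial :: "'p set \<Rightarrow> 'p set \<Rightarrow> ('p xyvar, 'k::field) mpoly" where
  "u_monomial P I = (\<Prod>p\<in>I. var (X p)) * (\<Prod>p\<in>P - I. var (Y p))"

definition H_ideal :: "'p set \<Rightarrow> 'p rel \<Rightarrow> ('p xyvar, 'k::field) mpoly set" where
  "H_ideal P r = genideal (poly_ring (xy_vars P)) (u_monomial P ` poset_ideals P r)"

definition H_component :: "'p set \<Rightarrow> 'p rel \<Rightarrow> nat \<Rightarrow> ('p xyvar, 'k::field) mpoly set" where
  "H_component P r d = H_ideal P r \<inter> poly_component (xy_vars P) d"

text \<open>The symbol \<open>e(I,T)\<close> is encoded as the pair \<open>(I, T)\<close>.\<close>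

definition e_basis :: "'p set \<Rightarrow> 'p rel \<Rightarrow> nat \<Rightarrow> ('p set \<times> 'p set) set" where
  "e_basis P r i = {(I, T). I \<in> poset_ideals P r \<and> T \<subseteq> P \<and> I \<inter> T \<subseteq> maximal_elements r I \<and>
     card (I \<inter> T) = i \<and> card I + card T = card P + i}"

text \<open>Here \<open>s\<close> is the chosen total order.\<close>

definition position :: "'p rel \<Rightarrow> 'p set \<Rightarrow> 'p \<Rightarrow> nat" where
  "position s Q p = card {q \<in> Q. (q, p) \<in> s \<and> q \<noteq> p}"

definition e_boundary ::
  "'p rel \<Rightarrow> 'p set \<times> 'p set \<Rightarrow> ('p set \<times> 'p set \<Rightarrow>\<^sub>0 ('p xyvar, 'k::field) mpoly)"
where
  "e_boundary s = (\<lambda>(I, T). \<Sum>p\<in>I \<inter> T.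
     Poly_Mapping.single (I - {p}, T) ((-1) ^ position s (I \<inter> T) p * var (X p)) -
     Poly_Mapping.single (I, T - {p}) ((-1) ^ position s (I \<inter> T) p * var (Y p)))"

end

theory Submission
  imports Defs
begin

text \<open>The resolution is multigraded. A monomial \<open>m\<close> is divisible by the multidegree
  \<open>\<Prod>\<^sub>I x\<^sub>p \<Prod>\<^sub>T y\<^sub>p\<close> of \<open>e(I,T)\<close> iff \<open>I\<close> lies in the set \<open>U\<close> of all \<open>p\<close> with
  \<open>x\<^sub>p\<close> dividing \<open>m\<close>, and \<open>T\<close> in the set \<open>W\<close> of all \<open>p\<close> with \<open>y\<^sub>p\<close> dividing \<open>m\<close>. The strand in
  degree \<open>m\<close> is thus the augmented chain complex of a cube complex whose cells are the pairs \<open>(I,T)\<close>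
  with \<open>I \<subseteq> U\<close> and \<open>T \<subseteq> W\<close>. All these \<open>I\<close> contain the poset ideal \<open>I\<^sub>0\<close> generated by
  \<open>P - W\<close>, and the complex collapses to the vertex \<open>I\<^sub>0\<close>: the greatest element \<open>p\<close> of \<open>I - I\<^sub>0\<close> for the
  total order is maximal in \<open>I\<close>, and matching \<open>(I,T)\<close>, \<open>p \<notin> T\<close>, with \<open>(I, T \<union> {p})\<close> gives a
  homotopy \<open>h\<close> for which \<open>1 - \<partial>h - h\<partial>\<close> shrinks \<open>I - I\<^sub>0\<close>.\<close>

text \<open>The total order fixes the signs and also selects the matching. Anything above
  \<open>p\<close> in \<open>I\<close> lies outside the down-closed set \<open>I\<^sub>0\<close>, so
  it cannot exceed \<open>p\<close> in an order extending the partial one; hence \<open>p\<close> is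
  maximal. Since \<open>I \<inter> T\<close> avoids \<open>I\<^sub>0\<close>, the element
  \<open>p\<close> is moreover the last one of \<open>I \<inter> (T \<union> {p})\<close>, so its
  sign there is (-1) to the power |\<open>I \<inter> T\<close>|. This dictates the sign of
  \<open>h\<close>.

  The map \<open>h\<close> is not a contraction in one step. What remains of a cell
  \<open>(I, T)\<close> is \<open>(I - {p}, T \<union> {p})\<close> if \<open>p \<notin> T\<close>,
  and otherwise, up to sign, \<open>h (I - {p}, T)\<close>, which is governed by the next greatest
  element. Exactness is therefore obtained by induction on |\<open>I - I\<^sub>0\<close>|. A strand
  with \<open>I\<^sub>0\<close> not contained in \<open>U\<close> has no cells at all, so it
  requires no separate case.

  The augmentation sends \<open>e(I, P - I)\<close> to \<open>u\<^sub>I\<close>; in each strand it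
  becomes the sum of the coefficients. Working strand by strand leaves only signs and field
  coefficients to compute with.\<close>

abbreviation "lookup \<equiv> Poly_Mapping.lookup"
abbreviation "single \<equiv> Poly_Mapping.single"
abbreviation "keys \<equiv> Poly_Mapping.keys"
abbreviation "scale a \<equiv> Poly_Mapping.map ((*) a)"

section \<open>Finitely supported functions\<close>

lemma poly_mapping_eq_sum_single: "v = (\<Sum>b\<in>keys v. single b (lookup v b))"
  for v :: "'b \<Rightarrow>\<^sub>0 'r::comm_monoid_add"
proof (rule poly_mapping_eqI)
  fix k
  show "lookup v k = lookup (\<Sum>b\<in>keys v. single b (lookup v b)) k"
    by (cases "k \<in> keys v")
      (auto simp: lookup_sum lookup_single when_def in_keys_iff sum.delta)
qed

text \<open>A finitely supported function is the sum of its one-point parts. The set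
  \<open>A\<close> restricts the induction to the cells of one strand, the only ones on which
  \<open>assemble\<close> is meaningful.\<close>

lemma poly_mapping_additive_induct [consumes 1, case_names zero single add]:
  fixes v :: "'b \<Rightarrow>\<^sub>0 'r::comm_monoid_add"
  assumes "keys v \<subseteq> A" and zero: "P 0"
    and single: "\<And>b a. b \<in> A \<Longrightarrow> P (single b a)"
    and add: "\<And>x y. P x \<Longrightarrow> P y \<Longrightarrow> P (x + y)"
  shows "P v"
proof -
  have "P (\<Sum>b\<in>B. single b (lookup v b))" if "B \<subseteq> keys v" for B
    using finite_subset [OF that finite_keys] that
    by (induction B rule: finite_induct) (use assms in auto)
  from this [of "keys v"] show ?thesis
    by (simp flip: poly_mapping_eq_sum_single)
qed

lemma keys_diff_subset: "keys x \<subseteq> A \<Longrightarrow> keys y \<subseteq> A \<Longrightarrow> keys (x - y) \<subseteq> A"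
  for x y :: "'b \<Rightarrow>\<^sub>0 'r::ab_group_add"
  by (auto simp: subset_iff in_keys_iff lookup_minus) (metis diff_self)

lemma keys_add_subset: "keys x \<subseteq> A \<Longrightarrow> keys y \<subseteq> A \<Longrightarrow> keys (x + y) \<subseteq> A"
  by (rule order_trans [OF keys_add Un_least])

lemma keys_sum_subset: "(\<And>i. i \<in> I \<Longrightarrow> keys (f i) \<subseteq> A) \<Longrightarrow> keys (sum f I) \<subseteq> A"
  by (rule order_trans [OF keys_sum]) (rule UN_least)

lemma lookup_scale: "lookup (scale a v) b = a * lookup v b"
  for v :: "'b \<Rightarrow>\<^sub>0 'r::comm_ring_1"
  by (simp add: Poly_Mapping.map.rep_eq when_def)

lemma scale_add: "scale a (v + w) = scale a v + scale a w"
  for v w :: "'b \<Rightarrow>\<^sub>0 'r::comm_ring_1"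
  by (rule poly_mapping_eqI) (simp add: lookup_scale lookup_add distrib_left)

lemma scale_diff: "scale a (v - w) = scale a v - scale a w"
  for v w :: "'b \<Rightarrow>\<^sub>0 'r::comm_ring_1"
  by (rule poly_mapping_eqI) (simp add: lookup_scale lookup_minus right_diff_distrib)

lemma scale_left_add: "scale (a + b) v = scale a v + scale b v"
  for v :: "'b \<Rightarrow>\<^sub>0 'r::comm_ring_1"
  by (rule poly_mapping_eqI) (simp add: lookup_scale lookup_add distrib_right)

lemma scale_scale: "scale a (scale b v) = scale (a * b) v"
  for v :: "'b \<Rightarrow>\<^sub>0 'r::comm_ring_1"
  by (rule poly_mapping_eqI) (simp add: lookup_scale mult.assoc)

lemma scale_0_left: "scale 0 v = 0" for v :: "'b \<Rightarrow>\<^sub>0 'r::comm_ring_1"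
  by (rule poly_mapping_eqI) (simp add: lookup_scale)

lemma scale_0_right: "scale a 0 = 0" for a :: "'r::comm_ring_1"
  by (rule poly_mapping_eqI) (simp add: lookup_scale)

lemma scale_sum: "scale a (\<Sum>i\<in>I. f i) = (\<Sum>i\<in>I. scale a (f i))" for a :: "'r::comm_ring_1"
  by (induction I rule: infinite_finite_induct) (simp_all add: scale_add scale_0_right)

lemma scale_single: "scale a (single b c) = single b (a * c)" for a :: "'r::comm_ring_1"
  by simp

lemma keys_scale: "keys (scale a v) \<subseteq> keys v" for a :: "'r::comm_ring_1"
  by (auto simp: in_keys_iff lookup_scale)

section \<open>Linear maps and functionals given by their values on a basis\<close>

lemma linear_extension_superset:
  "finite A \<Longrightarrow> keys v \<subseteq> A \<Longrightarrow> linear_extension g v = (\<Sum>b\<in>A. scale (lookup v b) (g b))"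
  unfolding linear_extension_def
  by (rule sum.mono_neutral_left) (auto simp: in_keys_iff scale_0_left)

lemma linear_extension_add:
  "linear_extension g (v + w) = linear_extension g v + linear_extension g w"
proof -
  let ?A = "keys v \<union> keys w"
  have "keys (v + w) \<subseteq> ?A"
    by (rule keys_add)
  then show ?thesis
    by (subst (1 2 3) linear_extension_superset [where A = ?A])
      (auto simp: lookup_add scale_left_add sum.distrib)
qed

lemma linear_extension_0: "linear_extension g 0 = 0"
  by (simp add: linear_extension_def)

lemma linear_extension_single: "linear_extension g (single b a) = scale a (g b)"
  by (simp add: linear_extension_def scale_0_left)

lemma linear_extension_scale:
  "linear_extension g (scale a v) = scale a (linear_extension g v)"
  using linear_extension_superset [of "keys v" "scale a v" g] keys_scale [of a v]
  by (simp add: lookup_scale linear_extension_def scale_sum scale_scale)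

lemma linear_extension_diff:
  "linear_extension g (v - w) = linear_extension g v - linear_extension g w"
  using linear_extension_add [of g "v - w" w] by simp

lemma linear_extension_sum:
  "linear_extension g (\<Sum>i\<in>I. f i) = (\<Sum>i\<in>I. linear_extension g (f i))"
  by (induction I rule: infinite_finite_induct)
    (simp_all add: linear_extension_add linear_extension_0)

text \<open>Because of this, \<partial>\<partial> = 0 and the homotopy identity need to be computed
  on single cells only.\<close>

lemma linear_extension_compose:
  "linear_extension g (linear_extension h v) = linear_extension (\<lambda>b. linear_extension g (h b)) v"
  by (simp add: linear_extension_def [of h] linear_extension_sum linear_extension_scale
      linear_extension_def [of "\<lambda>b. linear_extension g (h b)"])

lemma linear_extension_id: "linear_extension (\<lambda>b. single b 1) v = v"
  by (simp add: linear_extension_def flip: poly_mapping_eq_sum_single)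

lemma linear_extension_fun_diff:
  "linear_extension (\<lambda>b. f b - g b) v = linear_extension f v - linear_extension g v"
  by (simp add: linear_extension_def scale_diff sum_subtractf)

lemma linear_extension_eq_0:
  "(\<And>b. b \<in> keys v \<Longrightarrow> g b = 0) \<Longrightarrow> linear_extension g v = 0"
  by (simp add: linear_extension_def scale_0_right)

lemma keys_linear_extension:
  assumes "\<And>b. b \<in> keys v \<Longrightarrow> keys (g b) \<subseteq> A"
  shows "keys (linear_extension g v) \<subseteq> A"
  unfolding linear_extension_def
  by (intro keys_sum_subset order_trans [OF keys_scale] assms)

text \<open>The counterpart of \<open>linear_extension\<close> with values in the ring itself. It
  serves twice: with the values \<open>u\<^sub>I\<close> it is the augmentation, with the constant
  value 1 it is the augmentation of a strand.\<close>

definition linear_form :: "('b \<Rightarrow> 'r) \<Rightarrow> ('b \<Rightarrow>\<^sub>0 'r::comm_ring_1) \<Rightarrow> 'r" where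
  "linear_form f v = (\<Sum>b\<in>keys v. lookup v b * f b)"

lemma linear_form_superset:
  "finite A \<Longrightarrow> keys v \<subseteq> A \<Longrightarrow> linear_form f v = (\<Sum>b\<in>A. lookup v b * f b)"
  unfolding linear_form_def
  by (rule sum.mono_neutral_left) (auto simp: in_keys_iff)

lemma linear_form_add: "linear_form f (v + w) = linear_form f v + linear_form f w"
proof -
  let ?A = "keys v \<union> keys w"
  have "keys (v + w) \<subseteq> ?A"
    by (rule keys_add)
  then show ?thesis
    by (subst (1 2 3) linear_form_superset [where A = ?A])
      (auto simp: lookup_add distrib_right sum.distrib)
qed

lemma linear_form_0: "linear_form f 0 = 0"
  by (simp add: linear_form_def)

lemma linear_form_single: "linear_form f (single b a) = a * f b"
  by (simp add: linear_form_def)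

lemma linear_form_scale: "linear_form f (scale a v) = a * linear_form f v"
  using linear_form_superset [of "keys v" "scale a v" f] keys_scale [of a v]
  by (simp add: lookup_scale linear_form_def sum_distrib_left mult.assoc)

lemma linear_form_diff: "linear_form f (v - w) = linear_form f v - linear_form f w"
  using linear_form_add [of f "v - w" w] by simp

lemma linear_form_sum: "linear_form f (\<Sum>i\<in>I. g i) = (\<Sum>i\<in>I. linear_form f (g i))"
  by (induction I rule: infinite_finite_induct) (simp_all add: linear_form_add linear_form_0)

lemma linear_form_linear_extension:
  "linear_form f (linear_extension g v) = linear_form (\<lambda>b. linear_form f (g b)) v"
  by (simp add: linear_extension_def linear_form_sum linear_form_scale
      linear_form_def [of "\<lambda>b. linear_form f (g b)"])

section \<open>Boundaries of cubes of poset ideals\<close>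

text \<open>The specialisation of \<open>\<partial>\<close> to \<open>x\<^sub>p = y\<^sub>p = 1\<close>, i.e. the differential of every strand.\<close>

definition cube_boundary ::
  "'p rel \<Rightarrow> 'p set \<times> 'p set \<Rightarrow> ('p set \<times> 'p set \<Rightarrow>\<^sub>0 'k::comm_ring_1)" where
  "cube_boundary s = (\<lambda>(I, T). \<Sum>p\<in>I \<inter> T.
     single (I - {p}, T) ((-1) ^ position s (I \<inter> T) p) -
     single (I, T - {p}) ((-1) ^ position s (I \<inter> T) p))"

lemma cube_boundary_pair:
  "cube_boundary s (I, T) = (\<Sum>p\<in>I \<inter> T.
     single (I - {p}, T) ((-1) ^ position s (I \<inter> T) p) -
     single (I, T - {p}) ((-1) ^ position s (I \<inter> T) p))"
  by (simp add: cube_boundary_def)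

locale ordered_finite_poset =
  fixes P :: "'p set" and r s :: "'p rel"
  assumes finite_P: "finite P" and partial: "partial_order_on P r"
    and linear: "linear_order_on P s" and extends: "r \<subseteq> s"
begin

lemma finite_subset_P: "A \<subseteq> P \<Longrightarrow> finite A"
  using finite_P by (rule finite_subset [rotated])

lemma r_refl: "p \<in> P \<Longrightarrow> (p, p) \<in> r"
  using partial_order_onD(1) [OF partial] by (simp add: refl_on_def)

lemma r_trans: "(p, q) \<in> r \<Longrightarrow> (q, t) \<in> r \<Longrightarrow> (p, t) \<in> r"
  using partial_order_onD(2) [OF partial] by (rule transD)

lemma s_antisym: "(p, q) \<in> s \<Longrightarrow> (q, p) \<in> s \<Longrightarrow> p = q"
  using linear unfolding order_on_defs antisym_def by blast

lemma s_refl: "p \<in> P \<Longrightarrow> (p, p) \<in> s"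
  using linear unfolding order_on_defs refl_on_def by blast

lemma s_trans: "(p, q) \<in> s \<Longrightarrow> (q, t) \<in> s \<Longrightarrow> (p, t) \<in> s"
  using linear unfolding order_on_defs trans_def by blast

lemma s_total: "p \<in> P \<Longrightarrow> q \<in> P \<Longrightarrow> (p, q) \<in> s \<or> (q, p) \<in> s"
  using linear s_refl [of p] by (cases "p = q") (auto simp: linear_order_on_def total_on_def)

section \<open>Signs given by positions in the total order\<close>

lemma position_remove_smaller:
  assumes "A \<subseteq> P" "p \<in> A" "(p, q) \<in> s" "p \<noteq> q"
  shows "position s A q = Suc (position s (A - {p}) q)"
proof -
  have "{t \<in> A. (t, q) \<in> s \<and> t \<noteq> q} = insert p {t \<in> A - {p}. (t, q) \<in> s \<and> t \<noteq> q}"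
    using assms by auto
  then show ?thesis
    using finite_subset_P [OF assms(1)] by (simp add: position_def)
qed

lemma position_remove_larger:
  assumes "(p, q) \<in> s" "p \<noteq> q"
  shows "position s (A - {q}) p = position s A p"
proof -
  have "{t \<in> A - {q}. (t, p) \<in> s \<and> t \<noteq> p} = {t \<in> A. (t, p) \<in> s \<and> t \<noteq> p}"
    using assms s_antisym by auto
  then show ?thesis
    by (simp add: position_def)
qed

lemma position_greatest:
  assumes "A \<subseteq> P" "p \<in> P" "\<And>q. q \<in> A \<Longrightarrow> (q, p) \<in> s"
  shows "position s A p = card (A - {p})"
  unfolding position_def by (rule arg_cong [where f = card]) (use assms in auto)

text \<open>Deleting the smaller of \<open>p\<close> and \<open>q\<close> lowers the position of the
  other by one, while deleting the larger changes nothing. The two orders of deletion thus differ by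
  exactly one sign.\<close>

lemma position_swap:
  assumes "A \<subseteq> P" "p \<in> A" "q \<in> A" "p \<noteq> q"
  shows "(-1) ^ position s A p * (-1) ^ position s (A - {p}) q
    = - ((-1) ^ position s A q * (-1) ^ position s (A - {q}) p :: 'k::comm_ring_1)"
proof -
  have *: "(-1) ^ position s A p * (-1) ^ position s (A - {p}) q
    = - ((-1) ^ position s A q * (-1) ^ position s (A - {q}) p :: 'k::comm_ring_1)"
    if "p \<in> A" "q \<in> A" "(p, q) \<in> s" "p \<noteq> q" for p q
    using that position_remove_smaller [of A p q] position_remove_larger [of p q A] assms(1)
    by (simp add: mult.commute)
  consider "(p, q) \<in> s" | "(q, p) \<in> s"
    using s_total [of p q] assms by blast
  then show ?thesis
  proof cases
    case 1
    then show ?thesis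
      by (intro * assms)
  next
    case 2
    then show ?thesis
      using * [of q p] assms by simp
  qed
qed

text \<open>Pairing \<open>(p, q)\<close> with \<open>(q, p)\<close> by means of the order also covers characteristic 2, where
  \<open>x = - x\<close> does not give \<open>x = 0\<close>.\<close>

lemma sum_antisymmetric_eq_0:
  fixes g :: "'p \<Rightarrow> 'p \<Rightarrow> 'b::ab_group_add"
  assumes "A \<subseteq> P" and anti: "\<And>p q. p \<in> A \<Longrightarrow> q \<in> A \<Longrightarrow> p \<noteq> q \<Longrightarrow> g p q = - g q p"
  shows "(\<Sum>p\<in>A. \<Sum>q\<in>A - {p}. g p q) = 0"
proof -
  have fin: "finite A"
    using assms(1) by (rule finite_subset_P)
  let ?L = "{(p, q) \<in> A \<times> A. (p, q) \<in> s \<and> p \<noteq> q}"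
  let ?G = "{(p, q) \<in> A \<times> A. (q, p) \<in> s \<and> p \<noteq> q}"
  have "finite (A \<times> A)"
    using fin by simp
  then have finL: "finite ?L" and finG: "finite ?G"
    by (auto elim!: finite_subset [rotated])
  have *: "(SIGMA p:A. A - {p}) = ?L \<union> ?G"
    using assms(1) s_total by blast
  have "(\<Sum>p\<in>A. \<Sum>q\<in>A - {p}. g p q) = (\<Sum>(p, q)\<in>(SIGMA p:A. A - {p}). g p q)"
    using fin by (subst sum.Sigma) auto
  also have "\<dots> = (\<Sum>(p, q)\<in>?L \<union> ?G. g p q)"
    by (simp only: *)
  also have "\<dots> = (\<Sum>(p, q)\<in>?L. g p q) + (\<Sum>(p, q)\<in>?G. g p q)"
    using finL finG s_antisym by (intro sum.union_disjoint) auto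
  also have "(\<Sum>(p, q)\<in>?G. g p q) = (\<Sum>(p, q)\<in>?L. g q p)"
    by (rule sum.reindex_bij_witness [where i = prod.swap and j = prod.swap]) auto
  also have "\<dots> = (\<Sum>(p, q)\<in>?L. - g p q)"
    by (rule sum.cong) (auto dest: anti)
  finally show ?thesis
    by (simp add: sum_negf case_prod_unfold)
qed

text \<open>Since |\<open>I\<close>| + |\<open>T\<close>| = |\<open>I \<union> T\<close>| +
  |\<open>I \<inter> T\<close>|, the numerical condition on a symbol says that
  \<open>I \<union> T\<close> has as many elements as \<open>P\<close>, hence is
  \<open>P\<close>.\<close>

lemma mem_e_basis_iff:
  "(I, T) \<in> e_basis P r i \<longleftrightarrow> I \<in> poset_ideals P r \<and> T \<subseteq> P \<and> I \<union> T = P \<and>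
     I \<inter> T \<subseteq> maximal_elements r I \<and> card (I \<inter> T) = i"
proof (cases "I \<in> poset_ideals P r \<and> T \<subseteq> P")
  case True
  then have "I \<subseteq> P" "T \<subseteq> P"
    by (auto simp: poset_ideals_def)
  then have "finite I" "finite T"
    by (auto intro: finite_subset_P)
  then have "card I + card T = card (I \<union> T) + card (I \<inter> T)"
    by (rule card_Un_Int)
  moreover have "card (I \<union> T) = card P \<longleftrightarrow> I \<union> T = P"
    using card_subset_eq [OF finite_P, of "I \<union> T"] \<open>I \<subseteq> P\<close> \<open>T \<subseteq> P\<close> by auto
  ultimately show ?thesis
    using True by (auto simp: e_basis_def)
qed (auto simp: e_basis_def)

lemma finite_e_basis: "finite (e_basis P r i)"
proof (rule finite_subset)
  show "e_basis P r i \<subseteq> Pow P \<times> Pow P"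
    by (auto simp: e_basis_def poset_ideals_def)
qed (use finite_P in simp)

lemma poset_ideal_remove:
  assumes "I \<in> poset_ideals P r" "p \<in> maximal_elements r I"
  shows "I - {p} \<in> poset_ideals P r"
  using assms unfolding poset_ideals_def maximal_elements_def by blast

lemma maximal_elements_remove:
  "q \<in> maximal_elements r I \<Longrightarrow> q \<noteq> p \<Longrightarrow> q \<in> maximal_elements r (I - {p})"
  by (auto simp: maximal_elements_def)

text \<open>An element of \<open>I \<inter> T\<close> deleted on one side survives on the other, so
  the union remains \<open>P\<close>. Deleting it from \<open>I\<close> leaves a poset ideal because
  it is maximal, and the other maximal elements stay maximal.\<close>

lemma e_basis_facets:
  assumes "(I, T) \<in> e_basis P r (Suc i)" "p \<in> I \<inter> T"
  shows "(I - {p}, T) \<in> e_basis P r i" and "(I, T - {p}) \<in> e_basis P r i"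
proof -
  have I: "I \<in> poset_ideals P r" "T \<subseteq> P" "I \<union> T = P" "I \<inter> T \<subseteq> maximal_elements r I"
    "card (I \<inter> T) = Suc i"
    using assms(1) by (simp_all add: mem_e_basis_iff)
  have eq: "(I - {p}) \<inter> T = I \<inter> T - {p}" "I \<inter> (T - {p}) = I \<inter> T - {p}"
    by auto
  have card: "card (I \<inter> T - {p}) = i"
    using assms(2) I by (simp add: card_Diff_singleton)
  show "(I - {p}, T) \<in> e_basis P r i"
    unfolding mem_e_basis_iff eq
    using poset_ideal_remove [of I p] maximal_elements_remove [of _ I p] I assms(2) card by auto
  show "(I, T - {p}) \<in> e_basis P r i"
    unfolding mem_e_basis_iff eq using I assms(2) card by auto
qed

text \<open>A term of \<partial>\<partial> arises from an ordered pair of distinct elements of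
  \<open>I \<inter> T\<close> together with a side from which each is deleted. Exchanging the order
  gives the same cell with the opposite sign.\<close>

lemma cube_boundary_boundary:
  assumes "b \<in> e_basis P r i"
  shows "linear_extension (cube_boundary s) (cube_boundary s b) =
    (0 :: 'p set \<times> 'p set \<Rightarrow>\<^sub>0 'k::comm_ring_1)"
proof -
  obtain I T where b: "b = (I, T)"
    by fastforce
  define A where "A = I \<inter> T"
  have "A \<subseteq> P"
    using assms by (auto simp: b A_def mem_e_basis_iff)
  have A1: "(I - {p}) \<inter> T = A - {p}" "I \<inter> (T - {p}) = A - {p}" for p
    by (auto simp: A_def)
  define t :: "'p \<Rightarrow> 'p \<Rightarrow> 'k" where
    "t p q = (-1) ^ position s A p * (-1) ^ position s (A - {p}) q" for p q
  \<comment> \<open>The four terms are the choices of sides for \<open>p\<close> and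
    \<open>q\<close>. Swapping \<open>p\<close> and \<open>q\<close> fixes the two outer cells and
    exchanges the two inner ones, so \<open>g\<close> inherits the antisymmetry of
    \<open>t\<close>.\<close>
  define g where "g p q = single (I - {p} - {q}, T) (t p q) - single (I - {p}, T - {q}) (t p q)
    - single (I - {q}, T - {p}) (t p q) + single (I, T - {p} - {q}) (t p q)" for p q
  have facets: "cube_boundary s (I - {p}, T) = (\<Sum>q\<in>A - {p}.
      single (I - {p} - {q}, T) ((-1) ^ position s (A - {p}) q) -
      single (I - {p}, T - {q}) ((-1) ^ position s (A - {p}) q :: 'k))"
    "cube_boundary s (I, T - {p}) = (\<Sum>q\<in>A - {p}.
      single (I - {q}, T - {p}) ((-1) ^ position s (A - {p}) q) -
      single (I, T - {p} - {q}) ((-1) ^ position s (A - {p}) q :: 'k))" for p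
    by (simp_all only: cube_boundary_pair A1)
  have "linear_extension (cube_boundary s) (cube_boundary s b) = (\<Sum>p\<in>A.
      scale ((-1) ^ position s A p) (cube_boundary s (I - {p}, T)) -
      scale ((-1) ^ position s A p) (cube_boundary s (I, T - {p}) :: _ \<Rightarrow>\<^sub>0 'k))"
    unfolding b by (simp only: cube_boundary_pair [of s I T] linear_extension_sum
        linear_extension_diff linear_extension_single A_def)
  also have "\<dots> = (\<Sum>p\<in>A. \<Sum>q\<in>A - {p}. g p q)"
  proof (rule sum.cong [OF refl])
    fix p
    show "scale ((-1) ^ position s A p) (cube_boundary s (I - {p}, T)) -
        scale ((-1) ^ position s A p) (cube_boundary s (I, T - {p}) :: _ \<Rightarrow>\<^sub>0 'k)
        = (\<Sum>q\<in>A - {p}. g p q)"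
      unfolding facets scale_sum sum_subtractf [symmetric]
      by (rule sum.cong [OF refl])
        (simp only: scale_diff scale_single g_def t_def, simp only: algebra_simps)
  qed
  also have "\<dots> = 0"
  proof (rule sum_antisymmetric_eq_0 [OF \<open>A \<subseteq> P\<close>])
    fix p q
    assume "p \<in> A" "q \<in> A" "p \<noteq> q"
    then have "t p q = - t q p"
      unfolding t_def by (rule position_swap [OF \<open>A \<subseteq> P\<close>])
    then show "g p q = - g q p"
      by (simp add: g_def single_uminus Diff_insert2 [symmetric] insert_commute [of q p]
          algebra_simps)
  qed
  finally show ?thesis .
qed

text \<open>The two facets belonging to \<open>p\<close> carry opposite coefficients. This is the
  strand version of the vanishing of the augmentation on boundaries.\<close>

lemma linear_form_cube_boundary:
  "linear_form (\<lambda>_. 1) (cube_boundary s b) = (0 :: 'k::comm_ring_1)"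
proof -
  obtain I T where b: "b = (I, T)"
    by fastforce
  show ?thesis
    by (simp only: b cube_boundary_pair linear_form_sum linear_form_diff linear_form_single
        diff_self sum.neutral_const)
qed

section \<open>Acyclicity of the strands\<close>

text \<open>Parametrised by \<open>U\<close> and \<open>W\<close> instead of a monomial, since a
  strand depends only on which variables divide its multidegree, not on their exponents.\<close>

definition cells :: "'p set \<Rightarrow> 'p set \<Rightarrow> nat \<Rightarrow> ('p set \<times> 'p set) set" where
  "cells U W i = {b \<in> e_basis P r i. fst b \<subseteq> U \<and> snd b \<subseteq> W}"

text \<open>This is \<open>I\<^sub>0\<close>. A point outside \<open>W\<close> cannot lie in
  \<open>T\<close>, so \<open>I \<union> T = P\<close> forces it, and everything below it, into
  \<open>I\<close>.\<close>

definition bottom_ideal :: "'p set \<Rightarrow> 'p set" where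
  "bottom_ideal W = {q \<in> P. \<exists>w\<in>P - W. (q, w) \<in> r}"

text \<open>Arbitrary on the empty set; \<open>homotopy\<close> therefore tests for emptiness as
  well.\<close>

definition greatest :: "'p set \<Rightarrow> 'p" where
  "greatest Q = (SOME p. p \<in> Q \<and> (\<forall>q\<in>Q. (q, p) \<in> s))"

text \<open>The coefficient is that of \<open>(I, T)\<close> in the boundary of
  \<open>(I, insert p T)\<close>; being a sign, it is its own inverse, so \<partial>h reproduces
  \<open>(I, T)\<close> with coefficient 1.\<close>

definition homotopy :: "'p set \<Rightarrow> 'p set \<times> 'p set \<Rightarrow> ('p set \<times> 'p set \<Rightarrow>\<^sub>0 'k::comm_ring_1)"
where
  "homotopy W = (\<lambda>(I, T). let Q = I - bottom_ideal W; p = greatest Q in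
     if Q = {} \<or> p \<in> T then 0 else single (I, insert p T) (- ((-1) ^ card (I \<inter> T))))"

lemma greatest_eqI: "p \<in> Q \<Longrightarrow> (\<And>q. q \<in> Q \<Longrightarrow> (q, p) \<in> s) \<Longrightarrow> greatest Q = p"
  unfolding greatest_def by (rule some_equality) (auto intro: s_antisym)

lemma greatest_exists:
  assumes "Q \<subseteq> P" "Q \<noteq> {}"
  shows "greatest Q \<in> Q \<and> (\<forall>q\<in>Q. (q, greatest Q) \<in> s)"
proof -
  have "\<exists>p. p \<in> Q \<and> (\<forall>q\<in>Q. (q, p) \<in> s)"
    using finite_subset_P [OF assms(1)] assms(2,1)
  proof (induction Q rule: finite_ne_induct)
    case (singleton x)
    then show ?case
      using s_refl by auto
  next
    case (insert x F)
    then obtain p where p: "p \<in> F" "\<And>q. q \<in> F \<Longrightarrow> (q, p) \<in> s"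
      by auto
    have "x \<in> P" "p \<in> P"
      using insert.prems p by auto
    then consider "(x, p) \<in> s" | "(p, x) \<in> s"
      using s_total by blast
    then show ?case
    proof cases
      case 1
      then show ?thesis
        using p by auto
    next
      case 2
      then have "(q, x) \<in> s" if "q \<in> F" for q
        using s_trans p that by blast
      then show ?thesis
        using s_refl [OF \<open>x \<in> P\<close>] by auto
    qed
  qed
  then show ?thesis
    unfolding greatest_def by (rule someI_ex)
qed

lemma homotopy_eq_0:
  "I - bottom_ideal W = {} \<or> greatest (I - bottom_ideal W) \<in> T \<Longrightarrow> homotopy W (I, T) = 0"
  by (auto simp: homotopy_def Let_def)

lemma homotopy_eq_single:
  "greatest (I - bottom_ideal W) = p \<Longrightarrow> p \<in> I - bottom_ideal W \<Longrightarrow> p \<notin> T \<Longrightarrow>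
    homotopy W (I, T) = single (I, insert p T) (- ((-1) ^ card (I \<inter> T)))"
  by (auto simp: homotopy_def Let_def)

section \<open>The position of cells relative to the bottom ideal\<close>

lemma mem_cells_iff:
  "(I, T) \<in> cells U W i \<longleftrightarrow> I \<in> poset_ideals P r \<and> T \<subseteq> P \<and> I \<union> T = P \<and>
     I \<inter> T \<subseteq> maximal_elements r I \<and> card (I \<inter> T) = i \<and> I \<subseteq> U \<and> T \<subseteq> W"
  by (auto simp: cells_def mem_e_basis_iff)

lemma bottom_ideal_subset:
  assumes "(I, T) \<in> cells U W i"
  shows "bottom_ideal W \<subseteq> I"
proof
  fix q
  assume "q \<in> bottom_ideal W"
  then obtain w where w: "q \<in> P" "w \<in> P" "w \<notin> W" "(q, w) \<in> r"
    by (auto simp: bottom_ideal_def)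
  then have "w \<in> I"
    using assms by (auto simp: mem_cells_iff)
  then show "q \<in> I"
    using w assms by (auto simp: mem_cells_iff poset_ideals_def)
qed

text \<open>If \<open>q \<in> I \<inter> T\<close> lies below some \<open>w \<notin> W\<close>, then
  \<open>w\<close> is in \<open>I\<close>, and maximality of \<open>q\<close> gives
  \<open>w = q\<close>, contradicting \<open>T \<subseteq> W\<close>. Consequently
  \<open>I \<inter> T\<close> is contained in \<open>I - bottom_ideal W\<close> and bounded by its
  greatest element, and cells over the bottom ideal are vertices.\<close>

lemma bottom_ideal_disjoint:
  assumes "(I, T) \<in> cells U W i"
  shows "I \<inter> T \<inter> bottom_ideal W = {}"
proof (rule ccontr)
  assume "I \<inter> T \<inter> bottom_ideal W \<noteq> {}"
  then obtain q w where w: "q \<in> I" "q \<in> T" "w \<in> P" "w \<notin> W" "(q, w) \<in> r"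
    by (auto simp: bottom_ideal_def)
  then have "w \<in> I"
    using assms by (auto simp: mem_cells_iff)
  then have "w = q"
    using w assms by (auto simp: mem_cells_iff maximal_elements_def)
  then show False
    using w assms by (auto simp: mem_cells_iff)
qed

text \<open>If \<open>q \<in> I\<close> lies above \<open>p\<close>, then \<open>q\<close> is
  outside the bottom ideal, which is closed downwards; so \<open>q\<close> precedes \<open>p\<close>
  in \<open>s\<close>, and \<open>r \<subseteq> s\<close> with antisymmetry yields
  \<open>q = p\<close>. Membership in \<open>W\<close> holds because the bottom ideal contains
  \<open>P - W\<close>. Both facts are needed for \<open>p\<close> to be allowed in
  \<open>T\<close>.\<close>

lemma greatest_maximal:
  assumes "(I, T) \<in> cells U W i" "I - bottom_ideal W \<noteq> {}" "p = greatest (I - bottom_ideal W)"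
  shows "p \<in> I" "p \<notin> bottom_ideal W" "p \<in> P" "p \<in> W" "p \<in> maximal_elements r I"
    and "\<And>q. q \<in> I - bottom_ideal W \<Longrightarrow> (q, p) \<in> s"
proof -
  have I: "I \<subseteq> P" "I \<in> poset_ideals P r"
    using assms(1) by (auto simp: mem_cells_iff)
  have *: "p \<in> I - bottom_ideal W \<and> (\<forall>q\<in>I - bottom_ideal W. (q, p) \<in> s)"
    unfolding assms(3) by (rule greatest_exists) (use I assms(2) in auto)
  then show p: "p \<in> I" "p \<notin> bottom_ideal W" and "p \<in> P"
    and gr: "\<And>q. q \<in> I - bottom_ideal W \<Longrightarrow> (q, p) \<in> s"
    using I by auto
  then show "p \<in> W"
    using r_refl [of p] by (auto simp: bottom_ideal_def)
  have "q = p" if "q \<in> I" "(p, q) \<in> r" for q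
  proof -
    have "q \<notin> bottom_ideal W"
      using that p r_trans \<open>p \<in> P\<close> unfolding bottom_ideal_def by blast
    then have "(q, p) \<in> s"
      using gr that by auto
    then show ?thesis
      using that extends s_antisym by blast
  qed
  then show "p \<in> maximal_elements r I"
    using p by (auto simp: maximal_elements_def)
qed

text \<open>The preserved first component is recorded because the measure used in
  \<open>keys_defect\<close> depends on it alone.\<close>

lemma keys_homotopy:
  assumes "b \<in> cells U W i"
  shows "keys (homotopy W b :: _ \<Rightarrow>\<^sub>0 'k::comm_ring_1) \<subseteq> {b' \<in> cells U W (Suc i). fst b' = fst b}"
proof -
  obtain I T where b: "b = (I, T)"
    by fastforce
  define p where "p = greatest (I - bottom_ideal W)"
  show ?thesis
  proof (cases "I - bottom_ideal W = {} \<or> p \<in> T")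
    case True
    then show ?thesis
      unfolding b p_def by (subst homotopy_eq_0) auto
  next
    case False
    have IT: "(I, T) \<in> cells U W i"
      using assms b by simp
    have p: "p \<in> I" "p \<notin> bottom_ideal W" "p \<in> P" "p \<in> W" "p \<in> maximal_elements r I"
      using greatest_maximal [OF IT _ p_def] False by auto
    have "finite (I \<inter> T)"
      using IT by (intro finite_subset_P) (auto simp: mem_cells_iff)
    then have "(I, insert p T) \<in> cells U W (Suc i)"
      using p False IT unfolding mem_cells_iff by auto
    moreover have "homotopy W b = single (I, insert p T) (- ((-1) ^ card (I \<inter> T)) :: 'k)"
      unfolding b by (rule homotopy_eq_single) (use p False p_def in auto)
    ultimately show ?thesis
      by (auto simp: b)
  qed
qed

lemma keys_cube_boundary:
  assumes "b \<in> cells U W (Suc i)"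
  shows "keys (cube_boundary s b :: _ \<Rightarrow>\<^sub>0 'k::comm_ring_1) \<subseteq> cells U W i"
proof -
  obtain I T where b: "b = (I, T)"
    by fastforce
  have "(I - {p}, T) \<in> cells U W i" "(I, T - {p}) \<in> cells U W i" if "p \<in> I \<inter> T" for p
    using e_basis_facets [of I T i p] assms that by (auto simp: cells_def b)
  then show ?thesis
    unfolding b cube_boundary_pair
    by (intro keys_sum_subset keys_diff_subset) auto
qed

lemma cube_boundary_vertex:
  assumes "b \<in> cells U W 0"
  shows "cube_boundary s b = (0 :: _ \<Rightarrow>\<^sub>0 'k::comm_ring_1)"
proof -
  obtain I T where b: "b = (I, T)"
    by fastforce
  then have "finite (I \<inter> T)"
    using assms by (intro finite_subset_P) (auto simp: mem_cells_iff)
  then show ?thesis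
    using assms by (auto simp: b mem_cells_iff cube_boundary_pair)
qed

text \<open>The map 1 - \<partial>h - h\<partial> on basis elements. It changes a cycle only by a
  boundary, so a cycle may be replaced by its image when a preimage is sought.\<close>

definition defect :: "'p set \<Rightarrow> 'p set \<times> 'p set \<Rightarrow> ('p set \<times> 'p set \<Rightarrow>\<^sub>0 'k::comm_ring_1)" where
  "defect W b = single b 1 - linear_extension (cube_boundary s) (homotopy W b) -
     linear_extension (homotopy W) (cube_boundary s b)"

lemma linear_extension_homotopy_boundary:
  "linear_extension (homotopy W) (cube_boundary s (I, T)) = (\<Sum>q\<in>I \<inter> T.
     scale ((-1) ^ position s (I \<inter> T) q) (homotopy W (I - {q}, T)) -
     scale ((-1) ^ position s (I \<inter> T) q) (homotopy W (I, T - {q})))"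
  by (simp only: cube_boundary_pair linear_extension_sum linear_extension_diff
      linear_extension_single)

lemma defect_bottom:
  assumes "(I, T) \<in> cells U W i" "I - bottom_ideal W = {}"
  shows "defect W (I, T) = (single (I, T) 1 :: _ \<Rightarrow>\<^sub>0 'k::comm_ring_1)"
proof -
  have "I \<inter> T = {}"
    using bottom_ideal_disjoint [OF assms(1)] assms(2) by auto
  moreover have "homotopy W (I, T) = (0 :: _ \<Rightarrow>\<^sub>0 'k)"
    using assms(2) by (simp add: homotopy_eq_0)
  ultimately show ?thesis
    by (simp add: defect_def cube_boundary_pair linear_extension_0)
qed

lemma greatest_remove:
  assumes "(I, T) \<in> cells U W i" "I - bottom_ideal W \<noteq> {}" "p = greatest (I - bottom_ideal W)"
    and "q \<noteq> p"
  shows "greatest (I - {q} - bottom_ideal W) = p"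
  using greatest_maximal [OF assms(1-3)] assms(4) by (intro greatest_eqI) auto

text \<open>In the boundary of \<open>(I, insert p T)\<close> the two facets at \<open>p\<close> are
  \<open>(I, T)\<close> and the cell on the right. The facets at the other elements cancel against
  h\<partial>, because deleting \<open>q \<noteq> p\<close> from either side does not change the
  greatest element.\<close>

lemma defect_free:
  assumes IT: "(I, T) \<in> cells U W i" and ne: "I - bottom_ideal W \<noteq> {}"
    and p_def: "p = greatest (I - bottom_ideal W)" and "p \<notin> T"
  shows "defect W (I, T) = (single (I - {p}, insert p T) 1 :: _ \<Rightarrow>\<^sub>0 'k::comm_ring_1)"
proof -
  define A where "A = I \<inter> T"
  define e :: 'k where "e = (-1) ^ card A"
  define \<sigma> :: "'p \<Rightarrow> 'k" where "\<sigma> q = (-1) ^ position s A q" for q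
  note p = greatest_maximal [OF IT ne p_def]
  have AP: "A \<subseteq> P" and "finite A" and "p \<notin> A"
    using IT \<open>p \<notin> T\<close> finite_subset_P by (auto simp: A_def mem_cells_iff)
  have less: "(q, p) \<in> s" "q \<noteq> p" if "q \<in> A" for q
    using that p(6) bottom_ideal_disjoint [OF IT] \<open>p \<notin> T\<close> by (auto simp: A_def)
  have cap: "I \<inter> insert p T = insert p A"
    using p by (auto simp: A_def)
  have pos: "position s (insert p A) q = position s A q" if "q \<in> A" for q
    using position_remove_larger [of q p "insert p A"] less [OF that] \<open>p \<notin> A\<close> by simp
  \<comment> \<open>As \<open>p\<close> comes last in \<open>I \<inter> insert p T\<close>, its sign
    there is \<open>e\<close>; this matches the factor \<open>- e\<close> of the homotopy, and
    \<open>e * e = 1\<close>.\<close>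
  have pos_p: "position s (insert p A) p = card A"
    using position_greatest [of "insert p A" p] AP p(3) less(1) s_refl [OF p(3)] \<open>p \<notin> A\<close> by auto
  define g where "g q = (single (I - {q}, insert p T) (e * \<sigma> q) -
      single (I, insert p (T - {q})) (e * \<sigma> q) :: _ \<Rightarrow>\<^sub>0 'k)" for q
  have ee: "e * e = 1"
    by (simp add: e_def flip: power_add power_mult_distrib)
  have h: "homotopy W (I, T) = single (I, insert p T) (- e)"
    unfolding e_def A_def by (rule homotopy_eq_single) (use p p_def \<open>p \<notin> T\<close> in auto)
  have "linear_extension (cube_boundary s) (homotopy W (I, T)) =
      scale (- e) (cube_boundary s (I, insert p T))"
    by (simp only: h linear_extension_single)
  also have "cube_boundary s (I, insert p T) =
      (single (I - {p}, insert p T) e - single (I, insert p T - {p}) e) +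
      (\<Sum>q\<in>A. single (I - {q}, insert p T) (\<sigma> q) - single (I, insert p T - {q}) (\<sigma> q))"
    unfolding cube_boundary_pair cap using \<open>finite A\<close> \<open>p \<notin> A\<close>
    by (simp add: pos pos_p e_def \<sigma>_def)
  also have "insert p T - {p} = T"
    using \<open>p \<notin> T\<close> by simp
  also have "(\<Sum>q\<in>A. single (I - {q}, insert p T) (\<sigma> q) - single (I, insert p T - {q}) (\<sigma> q)) =
      (\<Sum>q\<in>A. single (I - {q}, insert p T) (\<sigma> q) - single (I, insert p (T - {q})) (\<sigma> q))"
  proof (rule sum.cong [OF refl])
    fix q
    assume "q \<in> A"
    then have "insert p T - {q} = insert p (T - {q})"
      using less by auto
    then show "single (I - {q}, insert p T) (\<sigma> q) - single (I, insert p T - {q}) (\<sigma> q) =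
      single (I - {q}, insert p T) (\<sigma> q) - single (I, insert p (T - {q})) (\<sigma> q)"
      by (simp only:)
  qed
  also have "scale (- e) ((single (I - {p}, insert p T) e - single (I, T) e) +
      (\<Sum>q\<in>A. single (I - {q}, insert p T) (\<sigma> q) - single (I, insert p (T - {q})) (\<sigma> q))) =
      single (I, T) 1 - single (I - {p}, insert p T) 1 - (\<Sum>q\<in>A. g q)"
    by (simp add: scale_add scale_diff scale_sum scale_single g_def ee single_uminus
        sum_subtractf sum_negf)
  finally have 1: "linear_extension (cube_boundary s) (homotopy W (I, T)) =
      single (I, T) 1 - single (I - {p}, insert p T) 1 - (\<Sum>q\<in>A. g q)" .
  have "linear_extension (homotopy W) (cube_boundary s (I, T)) = (\<Sum>q\<in>A. g q)"
    unfolding linear_extension_homotopy_boundary A_def [symmetric]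
  proof (rule sum.cong [OF refl])
    fix q
    assume "q \<in> A"
    have cap: "(I - {q}) \<inter> T = A - {q}" "I \<inter> (T - {q}) = A - {q}"
      by (auto simp: A_def)
    \<comment> \<open>Deleting \<open>q\<close> shrinks the intersection by one, so the homotopy has
      coefficient \<open>e\<close> on these facets and \<open>- e\<close> on \<open>(I, T)\<close>.
      This sign change makes the sums from \<partial>h and h\<partial> opposite.\<close>
    have "card A = Suc (card (A - {q}))"
      using \<open>finite A\<close> \<open>q \<in> A\<close> by (rule card.remove)
    then have sign: "- ((-1) ^ card (A - {q})) = e"
      by (simp add: e_def)
    have "homotopy W (I - {q}, T) = single (I - {q}, insert p T) (- ((-1) ^ card ((I - {q}) \<inter> T)) :: 'k)"
      using greatest_remove [OF IT ne p_def] p less(2) [OF \<open>q \<in> A\<close>] \<open>p \<notin> T\<close>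
      by (intro homotopy_eq_single) auto
    moreover have "homotopy W (I, T - {q}) =
        single (I, insert p (T - {q})) (- ((-1) ^ card (I \<inter> (T - {q}))) :: 'k)"
      using p p_def \<open>p \<notin> T\<close> by (intro homotopy_eq_single) auto
    ultimately show "scale ((-1) ^ position s A q) (homotopy W (I - {q}, T)) -
        scale ((-1) ^ position s A q) (homotopy W (I, T - {q})) = g q"
      by (simp only: cap sign g_def \<sigma>_def scale_single mult.commute)
  qed
  with 1 show ?thesis
    by (simp add: defect_def)
qed

text \<open>Here \<open>h\<close> vanishes on the cell, and on all facets at
  \<open>q \<noteq> p\<close>, where \<open>p\<close> is still the greatest element and still in
  \<open>T\<close>. Of the facets at \<open>p\<close>, \<open>(I, T - {p})\<close> is the partner of
  the cell and cancels the identity; only the image of \<open>(I - {p}, T)\<close> is left.\<close>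

lemma defect_matched:
  assumes IT: "(I, T) \<in> cells U W i" and ne: "I - bottom_ideal W \<noteq> {}"
    and p_def: "p = greatest (I - bottom_ideal W)" and "p \<in> T"
  shows "defect W (I, T) =
    scale (- ((-1) ^ position s (I \<inter> T) p)) (homotopy W (I - {p}, T) :: _ \<Rightarrow>\<^sub>0 'k::comm_ring_1)"
proof -
  define A where "A = I \<inter> T"
  define e :: 'k where "e = (-1) ^ position s A p"
  note p = greatest_maximal [OF IT ne p_def]
  have AP: "A \<subseteq> P" and "finite A" and "p \<in> A"
    using IT \<open>p \<in> T\<close> finite_subset_P p by (auto simp: A_def mem_cells_iff)
  have "(q, p) \<in> s" if "q \<in> A" for q
    using that p(6) bottom_ideal_disjoint [OF IT] by (auto simp: A_def)
  then have "position s A p = card (A - {p})"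
    using AP p(3) by (intro position_greatest) auto
  \<comment> \<open>The sign of \<open>p\<close> in the boundary agrees with the sign built into
    \<open>h\<close> at \<open>(I, T - {p})\<close> because \<open>p\<close> is the last element of
    \<open>I \<inter> T\<close>.\<close>
  then have sign: "(-1) ^ card (A - {p}) = e"
    by (simp add: e_def)
  have ee: "e * e = 1"
    by (simp add: e_def flip: power_add power_mult_distrib)
  have h: "homotopy W (I, T) = (0 :: _ \<Rightarrow>\<^sub>0 'k)"
    using p_def \<open>p \<in> T\<close> by (simp add: homotopy_eq_0)
  have "linear_extension (homotopy W) (cube_boundary s (I, T)) =
      (\<Sum>q\<in>A. if q = p then scale e (homotopy W (I - {p}, T)) -
        scale e (homotopy W (I, T - {p})) else 0 :: _ \<Rightarrow>\<^sub>0 'k)"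
    unfolding linear_extension_homotopy_boundary A_def [symmetric]
  proof (rule sum.cong [OF refl])
    fix q
    assume "q \<in> A"
    have "homotopy W (I - {q}, T) = (0 :: _ \<Rightarrow>\<^sub>0 'k)" "homotopy W (I, T - {q}) = (0 :: _ \<Rightarrow>\<^sub>0 'k)"
      if "q \<noteq> p"
      using greatest_remove [OF IT ne p_def that] p_def \<open>p \<in> T\<close> that
      by (auto intro!: homotopy_eq_0)
    then show "scale ((-1) ^ position s A q) (homotopy W (I - {q}, T)) -
        scale ((-1) ^ position s A q) (homotopy W (I, T - {q})) =
        (if q = p then scale e (homotopy W (I - {p}, T)) -
          scale e (homotopy W (I, T - {p})) else 0 :: _ \<Rightarrow>\<^sub>0 'k)"
      by (auto simp: e_def scale_0_right)
  qed
  also have "\<dots> = scale e (homotopy W (I - {p}, T)) - scale e (homotopy W (I, T - {p}))"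
    using \<open>finite A\<close> \<open>p \<in> A\<close> by simp
  also have "homotopy W (I, T - {p}) = single (I, T) (- e)"
  proof -
    have cap: "I \<inter> (T - {p}) = A - {p}" "insert p (T - {p}) = T"
      using \<open>p \<in> T\<close> by (auto simp: A_def)
    have "homotopy W (I, T - {p}) =
        single (I, insert p (T - {p})) (- ((-1) ^ card (I \<inter> (T - {p}))) :: 'k)"
      by (rule homotopy_eq_single) (use p p_def in auto)
    then show ?thesis
      by (simp only: cap sign)
  qed
  finally have "linear_extension (homotopy W) (cube_boundary s (I, T)) =
      scale e (homotopy W (I - {p}, T)) - scale e (single (I, T) (- e))" .
  then have "defect W (I, T) = single (I, T) 1 -
      (scale e (homotopy W (I - {p}, T)) - scale e (single (I, T) (- e)))"
    by (simp only: defect_def h linear_extension_0 diff_zero)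
  also have "scale e (single (I, T) (- e)) = - single (I, T) 1"
    by (simp only: scale_single mult_minus_right ee) (simp only: single_uminus)
  also have "single (I, T) 1 - (scale e (homotopy W (I - {p}, T)) - - single (I, T) 1) =
      - scale e (homotopy W (I - {p}, T))"
    by simp
  also have "\<dots> = scale (- e) (homotopy W (I - {p}, T))"
    by (rule poly_mapping_eqI) (simp add: lookup_scale)
  finally show ?thesis
    by (simp add: e_def A_def)
qed

text \<open>Apart from cells over the bottom ideal, which are fixed, every cell loses
  \<open>p\<close> from its first component. The truncated subtraction covers the fixed cells too,
  since their measure is 0.\<close>

lemma keys_defect:
  assumes "b \<in> cells U W i"
  shows "keys (defect W b :: _ \<Rightarrow>\<^sub>0 'k::comm_ring_1) \<subseteq>
    {b' \<in> cells U W i. card (fst b' - bottom_ideal W) \<le> card (fst b - bottom_ideal W) - 1}"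
proof -
  obtain I T where b: "b = (I, T)"
    by fastforce
  have IT: "(I, T) \<in> cells U W i"
    using assms b by simp
  define p where "p = greatest (I - bottom_ideal W)"
  have fin: "finite (I - bottom_ideal W)" "finite (I \<inter> T)"
    using IT by (auto intro!: finite_subset_P simp: mem_cells_iff)
  have card: "card (I - {p} - bottom_ideal W) \<le> card (I - bottom_ideal W) - 1"
    if "I - bottom_ideal W \<noteq> {}"
  proof -
    have "p \<in> I - bottom_ideal W"
      using greatest_maximal [OF IT that p_def] by auto
    moreover have "I - {p} - bottom_ideal W = I - bottom_ideal W - {p}"
      by auto
    ultimately show ?thesis
      by (simp add: card_Diff_singleton)
  qed
  consider "I - bottom_ideal W = {}" | "I - bottom_ideal W \<noteq> {}" "p \<notin> T"
    | "I - bottom_ideal W \<noteq> {}" "p \<in> T"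
    by blast
  then show ?thesis
  proof cases
    case 1
    have "defect W b = (single b 1 :: _ \<Rightarrow>\<^sub>0 'k)"
      unfolding b by (rule defect_bottom [OF IT 1])
    moreover have "card (I - bottom_ideal W) = 0"
      by (simp only: 1 card.empty)
    ultimately show ?thesis
      using assms by (simp add: b)
  next
    case 2
    note p = greatest_maximal [OF IT 2(1) p_def]
    have eq: "(I - {p}) \<inter> insert p T = I \<inter> T"
      using 2 by auto
    have "(I - {p}, insert p T) \<in> cells U W i"
      unfolding mem_cells_iff eq
      using IT p poset_ideal_remove [of I p] maximal_elements_remove [of _ I p] 2
      by (auto simp: mem_cells_iff)
    moreover have "defect W b = (single (I - {p}, insert p T) 1 :: _ \<Rightarrow>\<^sub>0 'k)"
      unfolding b by (rule defect_free [OF IT 2(1) p_def 2(2)])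
    ultimately show ?thesis
      using card [OF 2(1)] by (simp add: b)
  next
    case 3
    note p = greatest_maximal [OF IT 3(1) p_def]
    \<comment> \<open>Since \<open>p \<in> I \<inter> T\<close>, the cell is not a vertex: passing
      to \<open>(I - {p}, T)\<close> lowers the dimension by one, and \<open>h\<close> raises it
      again.\<close>
    have "i \<noteq> 0"
      using IT p 3 fin by (auto simp: mem_cells_iff)
    then obtain j where j: "i = Suc j"
      by (cases i) auto
    have "(I - {p}, T) \<in> cells U W j"
      using e_basis_facets [of I T j p] IT p 3 by (auto simp: cells_def j)
    from keys_homotopy [OF this] show ?thesis
      using card [OF 3(1)] unfolding b defect_matched [OF IT 3(1) p_def 3(2)]
      by (intro order_trans [OF keys_scale]) (auto simp: j)
  qed
qed

lemma defect_linear_extension: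
  "linear_extension (defect W) z = z - linear_extension (cube_boundary s) (linear_extension (homotopy W) z)
     - linear_extension (homotopy W) (linear_extension (cube_boundary s) z)"
proof -
  have "defect W = (\<lambda>b. single b 1 - linear_extension (cube_boundary s) (homotopy W b) -
      linear_extension (homotopy W) (cube_boundary s b) :: _ \<Rightarrow>\<^sub>0 'a)"
    by (rule ext) (rule defect_def)
  then show ?thesis
    by (simp only: linear_extension_fun_diff linear_extension_compose linear_extension_id)
qed

lemma keys_linear_extension_defect:
  assumes "keys z \<subseteq> {b \<in> cells U W i. card (fst b - bottom_ideal W) \<le> N}"
  shows "keys (linear_extension (defect W) z) \<subseteq>
    {b \<in> cells U W i. card (fst b - bottom_ideal W) \<le> N - 1}"
proof (rule keys_linear_extension)
  fix b
  assume "b \<in> keys z"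
  then have "b \<in> cells U W i" "card (fst b - bottom_ideal W) \<le> N"
    using assms by auto
  then show "keys (defect W b) \<subseteq> {b \<in> cells U W i. card (fst b - bottom_ideal W) \<le> N - 1}"
    using keys_defect [of b U W i] by fastforce
qed

section \<open>Exactness of a single strand\<close>

lemma cube_boundary_boundary_extension:
  assumes "keys z \<subseteq> e_basis P r i"
  shows "linear_extension (cube_boundary s) (linear_extension (cube_boundary s) z) = 0"
  unfolding linear_extension_compose
  by (rule linear_extension_eq_0, rule cube_boundary_boundary [of _ i]) (use assms in auto)

lemma keys_extension_homotopy:
  "keys z \<subseteq> cells U W i \<Longrightarrow> keys (linear_extension (homotopy W) z) \<subseteq> cells U W (Suc i)"
  using keys_homotopy by (intro keys_linear_extension) blast

lemma keys_extension_boundary: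
  "keys z \<subseteq> cells U W (Suc i) \<Longrightarrow> keys (linear_extension (cube_boundary s) z) \<subseteq> cells U W i"
  using keys_cube_boundary by (intro keys_linear_extension) blast

lemma card_le_card_P:
  assumes "b \<in> cells U W i"
  shows "card (fst b - bottom_ideal W) \<le> card P"
  using assms by (intro card_mono finite_P) (auto simp: cells_def e_basis_def poset_ideals_def)

text \<open>For a cycle \<open>z\<close> the chain z - \<partial>hz is a cycle with a smaller bound;
  if \<open>w\<close> is a preimage of it, then w + hz is one of \<open>z\<close>. At bound 0 all
  cells would lie over the bottom ideal and be vertices, so \<open>z\<close> is zero in positive
  dimension.\<close>

lemma strand_exact_aux:
  fixes z :: "'p set \<times> 'p set \<Rightarrow>\<^sub>0 'k::comm_ring_1"
  assumes "keys z \<subseteq> {b \<in> cells U W (Suc i). card (fst b - bottom_ideal W) \<le> N}"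
    and "linear_extension (cube_boundary s) z = 0"
  shows "\<exists>w. keys w \<subseteq> cells U W (Suc (Suc i)) \<and> linear_extension (cube_boundary s) w = z"
  using assms
proof (induction N arbitrary: z)
  case 0
  have "b \<notin> keys z" for b
  proof
    assume "b \<in> keys z"
    moreover obtain I T where "b = (I, T)"
      by fastforce
    ultimately have IT: "(I, T) \<in> cells U W (Suc i)" and "card (I - bottom_ideal W) = 0"
      using 0 by auto
    moreover have "finite I"
      using IT finite_subset_P by (auto simp: mem_cells_iff)
    ultimately have "I - bottom_ideal W = {}"
      by simp
    then have "I \<inter> T = {}"
      using bottom_ideal_disjoint [OF IT] by auto
    then show False
      using IT by (simp add: mem_cells_iff)
  qed
  then have "z = 0"
    by (metis equals0I keys_eq_empty)
  then show ?case
    by (intro exI [of _ 0]) (simp add: linear_extension_0)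
next
  case (Suc N)
  let ?d = "linear_extension (cube_boundary s) :: _ \<Rightarrow> (_ \<Rightarrow>\<^sub>0 'k)"
  let ?h = "linear_extension (homotopy W) z"
  have keys: "keys z \<subseteq> cells U W (Suc i)"
    using Suc.prems by auto
  have h: "keys ?h \<subseteq> cells U W (Suc (Suc i))"
    using keys by (rule keys_extension_homotopy)
  have eq: "linear_extension (defect W) z = z - ?d ?h"
    unfolding defect_linear_extension Suc.prems(2) by (simp add: linear_extension_0)
  have "?d (?d ?h) = 0"
    using h by (intro cube_boundary_boundary_extension [of _ "Suc (Suc i)"]) (auto simp: cells_def)
  then have "?d (linear_extension (defect W) z) = 0"
    using Suc.prems(2) by (simp add: eq linear_extension_diff)
  moreover have "keys (linear_extension (defect W) z) \<subseteq>
      {b \<in> cells U W (Suc i). card (fst b - bottom_ideal W) \<le> N}"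
    using keys_linear_extension_defect [OF Suc.prems(1)] by simp
  ultimately obtain w where w: "keys w \<subseteq> cells U W (Suc (Suc i))"
    "?d w = linear_extension (defect W) z"
    using Suc.IH by blast
  show ?case
  proof (intro exI conjI)
    show "keys (w + ?h) \<subseteq> cells U W (Suc (Suc i))"
      using w(1) h by (rule keys_add_subset)
    show "?d (w + ?h) = z"
      using w(2) by (simp add: linear_extension_add eq)
  qed
qed

lemma strand_exact:
  fixes z :: "'p set \<times> 'p set \<Rightarrow>\<^sub>0 'k::comm_ring_1"
  assumes "keys z \<subseteq> cells U W (Suc i)" and "linear_extension (cube_boundary s) z = 0"
  shows "\<exists>w. keys w \<subseteq> cells U W (Suc (Suc i)) \<and> linear_extension (cube_boundary s) w = z"
  using assms card_le_card_P by (intro strand_exact_aux [where N = "card P"]) auto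

lemma linear_form_cube_boundary_extension:
  "linear_form (\<lambda>_. 1) (linear_extension (cube_boundary s) w) = (0 :: 'k::comm_ring_1)"
  unfolding linear_form_linear_extension linear_form_cube_boundary
  by (simp add: linear_form_def)

text \<open>The cycle condition becomes the vanishing of the coefficient sum, which subtracting the
  boundary \<partial>hz does not affect. At bound 0 only the vertex \<open>b0\<close> over the
  bottom ideal can occur, and its coefficient is then the whole sum.\<close>

lemma strand_exact_0_aux:
  fixes z :: "'p set \<times> 'p set \<Rightarrow>\<^sub>0 'k::comm_ring_1"
  assumes "keys z \<subseteq> {b \<in> cells U W 0. card (fst b - bottom_ideal W) \<le> N}"
    and "linear_form (\<lambda>_. 1) z = 0"
  shows "\<exists>w. keys w \<subseteq> cells U W 1 \<and> linear_extension (cube_boundary s) w = z"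
  using assms
proof (induction N arbitrary: z)
  case 0
  define b0 where "b0 = (bottom_ideal W, P - bottom_ideal W)"
  have "keys z \<subseteq> {b0}"
  proof
    fix b
    assume "b \<in> keys z"
    moreover obtain I T where b: "b = (I, T)"
      by fastforce
    ultimately have IT: "(I, T) \<in> cells U W 0" and "card (I - bottom_ideal W) = 0"
      using 0 by auto
    moreover have "finite I"
      using IT finite_subset_P by (auto simp: mem_cells_iff)
    ultimately have "I = bottom_ideal W" "I \<inter> T = {}"
      using bottom_ideal_subset [OF IT] by (auto simp: mem_cells_iff)
    then show "b \<in> {b0}"
      using IT by (auto simp: b b0_def mem_cells_iff)
  qed
  moreover have "lookup z b0 = 0"
    using 0(2) linear_form_superset [OF _ \<open>keys z \<subseteq> {b0}\<close>, of "\<lambda>_. 1"] by simp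
  ultimately have "z = 0"
    by (metis empty_subsetI in_keys_iff keys_eq_empty singletonD subset_singletonD insertI1)
  then show ?case
    by (intro exI [of _ 0]) (simp add: linear_extension_0)
next
  case (Suc N)
  let ?d = "linear_extension (cube_boundary s) :: _ \<Rightarrow> (_ \<Rightarrow>\<^sub>0 'k)"
  let ?h = "linear_extension (homotopy W) z"
  have keys: "keys z \<subseteq> cells U W 0"
    using Suc.prems by auto
  have h: "keys ?h \<subseteq> cells U W 1"
    using keys_extension_homotopy [OF keys] by simp
  \<comment> \<open>A vertex has \<open>I \<inter> T = {}\<close> and hence an empty boundary sum,
    so the h\<partial> part of \<open>defect\<close> drops out.\<close>
  have "?d z = 0"
    by (rule linear_extension_eq_0, rule cube_boundary_vertex) (use keys in auto)
  then have eq: "linear_extension (defect W) z = z - ?d ?h"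
    unfolding defect_linear_extension by (simp add: linear_extension_0)
  have "linear_form (\<lambda>_. 1) (linear_extension (defect W) z) = 0"
    using Suc.prems(2) by (simp add: eq linear_form_diff linear_form_cube_boundary_extension)
  moreover have "keys (linear_extension (defect W) z) \<subseteq>
      {b \<in> cells U W 0. card (fst b - bottom_ideal W) \<le> N}"
    using keys_linear_extension_defect [OF Suc.prems(1)] by simp
  ultimately obtain w where w: "keys w \<subseteq> cells U W 1" "?d w = linear_extension (defect W) z"
    using Suc.IH by blast
  show ?case
  proof (intro exI conjI)
    show "keys (w + ?h) \<subseteq> cells U W 1"
      using w(1) h by (rule keys_add_subset)
    show "?d (w + ?h) = z"
      using w(2) by (simp add: linear_extension_add eq)
  qed
qed

lemma strand_exact_0:
  fixes z :: "'p set \<times> 'p set \<Rightarrow>\<^sub>0 'k::comm_ring_1"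
  assumes "keys z \<subseteq> cells U W 0" and "linear_form (\<lambda>_. 1) z = 0"
  shows "\<exists>w. keys w \<subseteq> cells U W 1 \<and> linear_extension (cube_boundary s) w = z"
  using assms card_le_card_P by (intro strand_exact_0_aux [where N = "card P"]) auto

end

section \<open>Assembling multigraded strands\<close>

text \<open>The exponent vector of the multidegree of \<open>e(I,T)\<close>. Deleting
  \<open>p\<close> from \<open>I\<close> or \<open>T\<close> divides by \<open>x\<^sub>p\<close> or
  \<open>y\<^sub>p\<close>, exactly the variable that \<partial> puts in front.\<close>

definition cell_exponent :: "'p set \<times> 'p set \<Rightarrow> ('p xyvar \<Rightarrow>\<^sub>0 nat)" where
  "cell_exponent b = (\<Sum>p\<in>fst b. single (X p) 1) + (\<Sum>p\<in>snd b. single (Y p) 1)"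

definition x_support :: "('p xyvar \<Rightarrow>\<^sub>0 nat) \<Rightarrow> 'p set" where
  "x_support m = {p. lookup m (X p) \<noteq> 0}"

definition y_support :: "('p xyvar \<Rightarrow>\<^sub>0 nat) \<Rightarrow> 'p set" where
  "y_support m = {p. lookup m (Y p) \<noteq> 0}"

lemma lookup_cell_exponent:
  assumes "finite (fst b)" "finite (snd b)"
  shows "lookup (cell_exponent b) (X p) = (if p \<in> fst b then 1 else 0)"
    and "lookup (cell_exponent b) (Y p) = (if p \<in> snd b then 1 else 0)"
  using assms by (simp_all add: cell_exponent_def lookup_add lookup_sum lookup_single when_def)

text \<open>The exponents of a cell are at most 1, so divisibility is containment of supports, and
  the truncated subtraction is then exact.\<close>

lemma cell_exponent_divides:
  assumes "finite (fst b)" "finite (snd b)" "fst b \<subseteq> x_support m" "snd b \<subseteq> y_support m"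
  shows "m - cell_exponent b + cell_exponent b = m"
proof (rule poly_mapping_eqI)
  fix v
  show "lookup (m - cell_exponent b + cell_exponent b) v = lookup m v"
    using assms by (cases v)
      (auto simp: lookup_add lookup_minus lookup_cell_exponent x_support_def y_support_def)
qed

lemma support_add_cell_exponent:
  assumes "finite (fst b)" "finite (snd b)"
  shows "fst b \<subseteq> x_support (m + cell_exponent b)" "snd b \<subseteq> y_support (m + cell_exponent b)"
  using assms by (auto simp: x_support_def y_support_def lookup_add lookup_cell_exponent)

lemma cell_exponent_remove:
  assumes "finite I" "finite T"
  shows "p \<in> I \<Longrightarrow> cell_exponent (I, T) = single (X p) 1 + cell_exponent (I - {p}, T)"
    and "p \<in> T \<Longrightarrow> cell_exponent (I, T) = single (Y p) 1 + cell_exponent (I, T - {p})"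
  using assms by (simp_all add: cell_exponent_def sum.remove [of _ p] ac_simps)

lemma prod_var: "(\<Prod>p\<in>A. var (f p)) = single (\<Sum>p\<in>A. single (f p) 1) 1"
  by (induction A rule: infinite_finite_induct) (simp_all add: var_def mult_single)

lemma u_monomial_eq_single: "u_monomial P I = single (cell_exponent (I, P - I)) 1"
  by (simp add: u_monomial_def prod_var mult_single cell_exponent_def)

lemma minus_one_power_single: "((-1) ^ n :: 'v \<Rightarrow>\<^sub>0 'k::comm_ring_1) = single 0 ((-1) ^ n)"
  for v :: "'v::comm_monoid_add"
  by (cases "even n") (simp_all add: single_uminus)

text \<open>Embeds the strand of multidegree \<open>m\<close> into the free module; meaningful only for cells whose
  exponent divides \<open>m\<close>, since the subtraction is truncated.\<close>

definition assemble :: "('p xyvar \<Rightarrow>\<^sub>0 nat) \<Rightarrow> ('p set \<times> 'p set \<Rightarrow>\<^sub>0 'k::field) \<Rightarrow>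
    ('p set \<times> 'p set \<Rightarrow>\<^sub>0 ('p xyvar, 'k) mpoly)" where
  "assemble m = Poly_Mapping.mapp (\<lambda>b. single (m - cell_exponent b))"

lemma lookup_assemble: "lookup (assemble m c) b = single (m - cell_exponent b) (lookup c b)"
  by (simp add: assemble_def lookup_mapp when_def in_keys_iff)

lemma keys_assemble: "keys (assemble m c) \<subseteq> keys c"
  by (simp add: assemble_def keys_mapp_subset)

lemma assemble_0: "assemble m 0 = 0"
  by (rule poly_mapping_eqI) (simp add: lookup_assemble)

lemma assemble_add: "assemble m (c + d) = assemble m c + assemble m d"
  by (rule poly_mapping_eqI) (simp add: lookup_assemble lookup_add single_add)

lemma assemble_diff: "assemble m (c - d) = assemble m c - assemble m d"
  by (rule poly_mapping_eqI) (simp add: lookup_assemble lookup_minus single_diff)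

lemma assemble_sum: "assemble m (\<Sum>i\<in>A. c i) = (\<Sum>i\<in>A. assemble m (c i))"
  by (induction A rule: infinite_finite_induct) (simp_all add: assemble_0 assemble_add)

lemma assemble_single: "assemble m (single b a) = single b (single (m - cell_exponent b) a)"
  by (rule poly_mapping_eqI) (simp add: lookup_assemble lookup_single when_def)

section \<open>The free modules as sums of strands\<close>

context ordered_finite_poset
begin

abbreviation strand_cells :: "('p xyvar \<Rightarrow>\<^sub>0 nat) \<Rightarrow> nat \<Rightarrow> ('p set \<times> 'p set) set" where
  "strand_cells m \<equiv> cells (x_support m) (y_support m)"

lemma finite_e_basis_sets:
  assumes "b \<in> e_basis P r i"
  shows "finite (fst b)" "finite (snd b)"
  using assms by (auto intro!: finite_subset_P simp: e_basis_def poset_ideals_def)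

lemma strand_cells_divides:
  "b \<in> strand_cells m i \<Longrightarrow> m - cell_exponent b + cell_exponent b = m"
  using finite_e_basis_sets [of b i] by (intro cell_exponent_divides) (auto simp: cells_def)

lemma e_boundary_pair:
  "e_boundary s (I, T) = (\<Sum>p\<in>I \<inter> T.
     single (I - {p}, T) ((-1) ^ position s (I \<inter> T) p * var (X p)) -
     single (I, T - {p}) ((-1) ^ position s (I \<inter> T) p * var (Y p)))"
  by (simp add: e_boundary_def)

text \<open>The differential preserves multidegrees: the variable in front of a facet makes up for
  the variable missing from its exponent, so only the sign is left in the strand.\<close>

lemma boundary_assemble_single:
  fixes a :: "'k::field"
  assumes "b \<in> strand_cells m i"
  shows "linear_extension (e_boundary s) (assemble m (single b a)) =
    assemble m (linear_extension (cube_boundary s) (single b a))"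
proof -
  obtain I T where b: "b = (I, T)"
    by fastforce
  define n where "n = m - cell_exponent b"
  have fin: "finite I" "finite T"
    using assms finite_e_basis_sets [of b i] by (auto simp: cells_def b)
  have m: "m = n + cell_exponent (I, T)"
    using strand_cells_divides [OF assms] by (simp add: n_def b)
  have n: "m - cell_exponent (I - {p}, T) = n + single (X p) 1"
    "m - cell_exponent (I, T - {p}) = n + single (Y p) 1" if "p \<in> I \<inter> T" for p
  proof -
    \<comment> \<open>Writing \<open>m\<close> as a sum ending in the exponent of the facet lets the
      truncated subtraction cancel exactly.\<close>
    have eq: "m = n + single (X p) 1 + cell_exponent (I - {p}, T)"
      "m = n + single (Y p) 1 + cell_exponent (I, T - {p})"
      using cell_exponent_remove [OF fin, of p] that unfolding m
      by (metis Int_iff add.assoc)+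
    show "m - cell_exponent (I - {p}, T) = n + single (X p) 1"
      by (subst eq(1)) (rule add_diff_cancel_right')
    show "m - cell_exponent (I, T - {p}) = n + single (Y p) 1"
      by (subst eq(2)) (rule add_diff_cancel_right')
  qed
  have "linear_extension (e_boundary s) (assemble m (single b a)) =
      (\<Sum>p\<in>I \<inter> T. single (I - {p}, T) (single n a * ((-1) ^ position s (I \<inter> T) p * var (X p))) -
        single (I, T - {p}) (single n a * ((-1) ^ position s (I \<inter> T) p * var (Y p))))"
    unfolding assemble_single linear_extension_single b e_boundary_pair scale_sum scale_diff
      scale_single n_def ..
  also have "\<dots> = (\<Sum>p\<in>I \<inter> T.
      assemble m (single (I - {p}, T) (a * (-1) ^ position s (I \<inter> T) p)) -
      assemble m (single (I, T - {p}) (a * (-1) ^ position s (I \<inter> T) p)))"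
    by (rule sum.cong [OF refl])
      (simp add: assemble_single n minus_one_power_single var_def mult_single)
  also have "\<dots> = assemble m (linear_extension (cube_boundary s) (single b a))"
    unfolding linear_extension_single b cube_boundary_pair scale_sum scale_diff
      scale_single assemble_sum assemble_diff ..
  finally show ?thesis .
qed

lemma boundary_assemble:
  assumes "keys c \<subseteq> strand_cells m i"
  shows "linear_extension (e_boundary s) (assemble m c) =
    assemble m (linear_extension (cube_boundary s) c)"
  using assms
proof (induction rule: poly_mapping_additive_induct)
  case zero
  then show ?case
    by (simp add: assemble_0 linear_extension_0)
next
  case (single b a)
  then show ?case
    by (rule boundary_assemble_single)
next
  case (add x y)
  then show ?case
    by (simp add: assemble_add linear_extension_add)
qed

text \<open>A vertex has \<open>T = P - I\<close>, so its exponent is that of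
  \<open>u\<^sub>I\<close>; the product of the cofactor with \<open>u\<^sub>I\<close> is the
  monomial \<open>m\<close>, whichever vertex is taken.\<close>

lemma augmentation_assemble:
  assumes "keys c \<subseteq> strand_cells m 0"
  shows "linear_form (\<lambda>b. u_monomial P (fst b)) (assemble m c) =
    single m (linear_form (\<lambda>_. 1) c)"
  using assms
proof (induction rule: poly_mapping_additive_induct)
  case zero
  then show ?case
    by (simp add: assemble_0 linear_form_0)
next
  case (single b a)
  obtain I T where b: "b = (I, T)"
    by fastforce
  have "I \<union> T = P" "finite I" "card (I \<inter> T) = 0"
    using single finite_subset_P by (auto simp: b mem_cells_iff)
  then have "P - I = T"
    by auto
  then show ?case
    using strand_cells_divides [OF single]
    by (simp add: b assemble_single linear_form_single u_monomial_eq_single mult_single)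
next
  case (add x y)
  then show ?case
    by (simp add: assemble_add linear_form_add single_add)
qed

text \<open>A term with monomial \<open>n\<close> at the cell \<open>b\<close> has multidegree
  \<open>n + cell_exponent b\<close>; collecting the terms of \<open>v\<close> by multidegree gives
  finitely many field-valued chains.\<close>

lemma strand_decomposition:
  fixes v :: "'p set \<times> 'p set \<Rightarrow>\<^sub>0 ('p xyvar, 'k::field) mpoly"
  assumes "v \<in> carrier (free_module (poly_ring (xy_vars P)) (e_basis P r i))"
  obtains \<M> c where "finite \<M>" "\<forall>m\<in>\<M>. keys m \<subseteq> xy_vars P"
    "\<forall>m\<in>\<M>. keys (c m) \<subseteq> strand_cells m i"
    "v = (\<Sum>m\<in>\<M>. assemble m (c m))"
proof -
  have keys_v: "keys v \<subseteq> e_basis P r i"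
    and coeff_v: "n \<in> keys (lookup v b) \<Longrightarrow> keys n \<subseteq> xy_vars P" for n b
    using assms by (cases b, fastforce simp: free_module_def poly_ring_def)+
  \<comment> \<open>The test on supports guards the truncated subtraction: otherwise a monomial not
    divisible by the exponent of \<open>b\<close> could pick up a coefficient as well.\<close>
  define c where "c m = Poly_Mapping.mapp (\<lambda>b f. if fst b \<subseteq> x_support m \<and> snd b \<subseteq> y_support m
    then lookup f (m - cell_exponent b) else 0) v" for m
  have lookup_c: "lookup (c m) b = (if b \<in> keys v \<and> fst b \<subseteq> x_support m \<and> snd b \<subseteq> y_support m
    then lookup (lookup v b) (m - cell_exponent b) else 0)" for m b
    by (simp add: c_def lookup_mapp when_def)
  define \<M> where "\<M> = (\<Union>b\<in>keys v. (\<lambda>n. n + cell_exponent b) ` keys (lookup v b))"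
  have fin_\<M>: "finite \<M>"
    by (simp add: \<M>_def)
  show ?thesis
  proof (rule that [of \<M> c]; (intro ballI)?)
    show "finite \<M>"
      by (fact fin_\<M>)
    show "keys m \<subseteq> xy_vars P" if m: "m \<in> \<M>" for m
    proof -
      obtain b n where b: "b \<in> keys v" "n \<in> keys (lookup v b)" "m = n + cell_exponent b"
        using m by (auto simp: \<M>_def)
      have "b \<in> e_basis P r i"
        using b keys_v by auto
      then have "fst b \<subseteq> P" "snd b \<subseteq> P"
        by (auto simp: e_basis_def poset_ideals_def)
      then have "keys (cell_exponent b) \<subseteq> xy_vars P"
        unfolding cell_exponent_def xy_vars_def
        by (intro keys_add_subset keys_sum_subset) auto
      then show ?thesis
        using coeff_v [OF b(2)] unfolding b(3) by (rule keys_add_subset [rotated])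
    qed
    show "keys (c m) \<subseteq> strand_cells m i" for m
      using keys_v by (auto simp: cells_def in_keys_iff [of _ "c m"] lookup_c split: if_splits)
    show "v = (\<Sum>m\<in>\<M>. assemble m (c m))"
    proof (intro poly_mapping_eqI)
      fix b n
      show "lookup (lookup v b) n = lookup (lookup (\<Sum>m\<in>\<M>. assemble m (c m)) b) n"
      proof (cases "b \<in> keys v")
        case True
        have fin: "finite (fst b)" "finite (snd b)"
          using finite_e_basis_sets [of b i] True keys_v by auto
        have "lookup (lookup (\<Sum>m\<in>\<M>. assemble m (c m)) b) n =
            (\<Sum>m\<in>\<M>. lookup (c m) b when m - cell_exponent b = n)"
          by (simp add: lookup_sum lookup_assemble lookup_single)
        \<comment> \<open>For a fixed cell, the monomial \<open>n\<close> comes from one multidegree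
          only; any other \<open>m\<close> with the same truncated difference is not divisible, and
          \<open>c m\<close> vanishes at \<open>b\<close>.\<close>
        also have "\<dots> = (\<Sum>m\<in>\<M>. if m = n + cell_exponent b then lookup (lookup v b) n else 0)"
        proof (rule sum.cong [OF refl])
          fix m
          show "(lookup (c m) b when m - cell_exponent b = n) =
            (if m = n + cell_exponent b then lookup (lookup v b) n else 0)"
            using support_add_cell_exponent [OF fin, of n] cell_exponent_divides [OF fin, of m] True
            by (auto simp: lookup_c when_def)
        qed
        also have "\<dots> = lookup (lookup v b) n"
        proof (cases "n \<in> keys (lookup v b)")
          case True
          then have "n + cell_exponent b \<in> \<M>"
            using \<open>b \<in> keys v\<close> by (auto simp: \<M>_def)
          then show ?thesis
            using fin_\<M> by simp
        next
          case False
          then have "lookup (lookup v b) n = 0"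
            by (simp add: in_keys_iff)
          then show ?thesis
            by (simp cong: if_cong)
        qed
        finally show ?thesis ..
      next
        case False
        then show ?thesis
          by (simp add: lookup_sum lookup_assemble lookup_c in_keys_iff)
      qed
    qed
  qed
qed

text \<open>For a fixed cell \<open>b\<close>, dividing by its exponent is injective on the
  monomials divisible by it, so different multidegrees contribute to different monomials of the
  coefficient at \<open>b\<close>.\<close>

lemma assemble_independent:
  fixes e :: "('p xyvar \<Rightarrow>\<^sub>0 nat) \<Rightarrow> ('p set \<times> 'p set \<Rightarrow>\<^sub>0 'k::field)"
  assumes "finite \<M>" "(\<Sum>m\<in>\<M>. assemble m (e m)) = 0"
    and keys: "\<And>m. m \<in> \<M> \<Longrightarrow> keys (e m) \<subseteq> strand_cells m i" and "m \<in> \<M>"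
  shows "e m = 0"
proof (rule poly_mapping_eqI)
  fix b
  show "lookup (e m) b = lookup 0 b"
  proof (cases "b \<in> strand_cells m i")
    case True
    have "0 = lookup (lookup (\<Sum>m\<in>\<M>. assemble m (e m)) b) (m - cell_exponent b)"
      by (simp add: assms(2))
    also have "\<dots> = (\<Sum>m'\<in>\<M>. lookup (e m') b when m' - cell_exponent b = m - cell_exponent b)"
      by (simp add: lookup_sum lookup_assemble lookup_single)
    also have "\<dots> = (\<Sum>m'\<in>\<M>. if m' = m then lookup (e m) b else 0)"
    proof (rule sum.cong [OF refl])
      fix m'
      assume "m' \<in> \<M>"
      show "(lookup (e m') b when m' - cell_exponent b = m - cell_exponent b) =
          (if m' = m then lookup (e m) b else 0)"
      proof (cases "b \<in> keys (e m')")
        case True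
        then have "b \<in> strand_cells m' i"
          using keys [OF \<open>m' \<in> \<M>\<close>] by auto
        then show ?thesis
          using strand_cells_divides [of b m' i] strand_cells_divides [OF \<open>b \<in> strand_cells m i\<close>]
          by (auto simp: when_def)
      qed (auto simp: in_keys_iff)
    qed
    also have "\<dots> = lookup (e m) b"
      using assms(1) \<open>m \<in> \<M>\<close> by simp
    finally show ?thesis
      by simp
  next
    case False
    then show ?thesis
      using keys [OF \<open>m \<in> \<M>\<close>] by (auto simp: in_keys_iff)
  qed
qed

lemma single_independent:
  assumes "finite \<M>" "(\<Sum>m\<in>\<M>. single m (e m)) = 0" "m \<in> \<M>"
  shows "e m = 0"
proof -
  have "0 = lookup (\<Sum>m\<in>\<M>. single m (e m)) m"
    by (simp add: assms(2))
  also have "\<dots> = e m"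
    using assms(1,3) by (simp add: lookup_sum lookup_single when_def)
  finally show ?thesis ..
qed

lemma assemble_in_free_module:
  assumes "keys m \<subseteq> xy_vars P" "keys c \<subseteq> strand_cells m i"
  shows "assemble m c \<in> carrier (free_module (poly_ring (xy_vars P)) (e_basis P r i))"
proof -
  have "keys (m - cell_exponent b) \<subseteq> keys m" for b :: "'p set \<times> 'p set"
    by (auto simp: in_keys_iff lookup_minus)
  then have "keys n \<subseteq> xy_vars P" if "n \<in> keys (lookup (assemble m c) b)" for n b
    using that assms(1) by (fastforce simp: lookup_assemble split: if_splits)
  moreover have "keys (assemble m c) \<subseteq> e_basis P r i"
    using keys_assemble [of m c] assms(2) by (auto simp: cells_def)
  ultimately show ?thesis
    by (simp add: free_module_def poly_ring_def)
qed

end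

section \<open>Polynomial rings and homogeneous ideals\<close>

lemma poly_ring_simps [simp]:
  "mult (poly_ring V) = (*)" "one (poly_ring V) = 1" "zero (poly_ring V) = 0"
  "add (poly_ring V) = (+)"
  by (simp_all add: poly_ring_def)

lemma carrier_poly_ring: "f \<in> carrier (poly_ring V) \<longleftrightarrow> (\<forall>m\<in>keys f. keys m \<subseteq> V)"
  by (simp add: poly_ring_def)

lemma poly_ring_0: "0 \<in> carrier (poly_ring V)"
  by (simp add: carrier_poly_ring)

lemma poly_ring_1: "1 \<in> carrier (poly_ring V)"
  by (simp add: carrier_poly_ring)

lemma poly_ring_add:
  "f \<in> carrier (poly_ring V) \<Longrightarrow> g \<in> carrier (poly_ring V) \<Longrightarrow> f + g \<in> carrier (poly_ring V)"
  using keys_add [of f g] unfolding carrier_poly_ring by blast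

lemma poly_ring_uminus: "f \<in> carrier (poly_ring V) \<Longrightarrow> - f \<in> carrier (poly_ring V)"
  by (simp add: carrier_poly_ring)

lemma poly_ring_mult:
  assumes "f \<in> carrier (poly_ring V)" "g \<in> carrier (poly_ring V)"
  shows "f * g \<in> carrier (poly_ring V)"
  unfolding carrier_poly_ring
proof
  fix m
  assume "m \<in> keys (f * g)"
  then obtain a b where "m = a + b" "a \<in> keys f" "b \<in> keys g"
    using keys_mult [of f g] by blast
  with assms show "keys m \<subseteq> V"
    by (simp add: carrier_poly_ring keys_add_subset)
qed

lemma poly_ring_var: "v \<in> V \<Longrightarrow> var v \<in> carrier (poly_ring V)"
  by (simp add: carrier_poly_ring var_def)

lemma cring_poly_ring: "cring (poly_ring V)"
proof (rule cringI)
  show "abelian_group (poly_ring V)"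
  proof (rule abelian_groupI)
    fix f
    assume "f \<in> carrier (poly_ring V)"
    then show "\<exists>g\<in>carrier (poly_ring V). g \<oplus>\<^bsub>poly_ring V\<^esub> f = \<zero>\<^bsub>poly_ring V\<^esub>"
      by (intro bexI [of _ "- f"]) (simp_all add: poly_ring_uminus)
  qed (simp_all add: poly_ring_0 poly_ring_add ac_simps)
  show "comm_monoid (poly_ring V)"
    by (rule comm_monoidI) (simp_all add: poly_ring_1 poly_ring_mult ac_simps)
qed (simp_all add: distrib_right)

interpretation poly_ring: cring "poly_ring V"
  by (rule cring_poly_ring)

lemma poly_ring_a_inv: "f \<in> carrier (poly_ring V) \<Longrightarrow> \<ominus>\<^bsub>poly_ring V\<^esub> f = - f"
  by (rule poly_ring.minus_equality) (simp_all add: poly_ring_uminus)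

text \<open>Only the additive inverse is not already an operation of the type: the abstract ring
  defines it through the carrier. Afterwards ideals can be handled with \<open>+\<close>,
  \<open>-\<close> and \<open>*\<close>.\<close>

lemma poly_ring_ideal_closed:
  assumes "ideal H (poly_ring V)"
  shows "0 \<in> H" and "f \<in> H \<Longrightarrow> g \<in> H \<Longrightarrow> f + g \<in> H" and "f \<in> H \<Longrightarrow> - f \<in> H"
    and "a \<in> carrier (poly_ring V) \<Longrightarrow> f \<in> H \<Longrightarrow> a * f \<in> H"
    and "f \<in> H \<Longrightarrow> f \<in> carrier (poly_ring V)"
proof -
  interpret ideal H "poly_ring V"
    by (rule assms)
  show "0 \<in> H" "f \<in> H \<Longrightarrow> g \<in> H \<Longrightarrow> f + g \<in> H"
    "a \<in> carrier (poly_ring V) \<Longrightarrow> f \<in> H \<Longrightarrow> a * f \<in> H" "f \<in> H \<Longrightarrow> f \<in> carrier (poly_ring V)"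
    using zero_closed a_closed [of f g] I_l_closed [of f a] a_Hcarr by simp_all
  show "- f \<in> H" if "f \<in> H"
    using a_inv_closed [OF that] a_Hcarr [OF that] by (simp add: poly_ring_a_inv)
qed

lemma poly_ring_ideal_sum:
  "ideal H (poly_ring V) \<Longrightarrow> (\<And>i. i \<in> A \<Longrightarrow> f i \<in> H) \<Longrightarrow> sum f A \<in> H"
  by (induction A rule: infinite_finite_induct) (auto intro: poly_ring_ideal_closed)

lemma ideal_module_simps [simp]:
  "carrier (ideal_module (poly_ring V) H) = H"
  "zero (ideal_module (poly_ring V) H) = 0"
  "add (ideal_module (poly_ring V) H) = (+)"
  "smult (ideal_module (poly_ring V) H) = (*)"
  by (simp_all add: ideal_module_def)

lemma module_ideal_module:
  assumes "ideal H (poly_ring V)"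
  shows "module (poly_ring V) (ideal_module (poly_ring V) H)"
proof (rule moduleI [OF cring_poly_ring])
  show "abelian_group (ideal_module (poly_ring V) H)"
  proof (rule abelian_groupI)
    fix f
    assume "f \<in> carrier (ideal_module (poly_ring V) H)"
    then show "\<exists>g\<in>carrier (ideal_module (poly_ring V) H).
        g \<oplus>\<^bsub>ideal_module (poly_ring V) H\<^esub> f = \<zero>\<^bsub>ideal_module (poly_ring V) H\<^esub>"
      using poly_ring_ideal_closed [OF assms] by (intro bexI [of _ "- f"]) simp_all
  qed (simp_all add: poly_ring_ideal_closed [OF assms] ac_simps)
qed (simp_all add: poly_ring_ideal_closed [OF assms] algebra_simps)

lemma finsum_ideal_module:
  assumes "ideal H (poly_ring V)" "finite A" "\<And>i. i \<in> A \<Longrightarrow> c i \<in> H"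
  shows "finsum (ideal_module (poly_ring V) H) c A = sum c A"
proof -
  interpret module "poly_ring V" "ideal_module (poly_ring V) H"
    by (rule module_ideal_module [OF assms(1)])
  show ?thesis
    using assms(2,3)
  proof (induction A rule: finite_induct)
    case (insert x F)
    then show ?case
      by (subst M.finsum_insert) auto
  qed simp
qed

section \<open>Total degree and homogeneous parts\<close>

lemma mon_degree_superset:
  "finite A \<Longrightarrow> keys m \<subseteq> A \<Longrightarrow> mon_degree m = (\<Sum>v\<in>A. lookup m v)"
  unfolding mon_degree_def by (rule sum.mono_neutral_left) (auto simp: in_keys_iff)

lemma mon_degree_add: "mon_degree (m + n) = mon_degree m + mon_degree n"
  using keys_add [of m n] mon_degree_superset [of "keys m \<union> keys n" m]
    mon_degree_superset [of "keys m \<union> keys n" n] mon_degree_superset [of "keys m \<union> keys n" "m + n"]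
  by (simp add: lookup_add sum.distrib)

lemma mon_degree_sum: "mon_degree (\<Sum>i\<in>A. f i) = (\<Sum>i\<in>A. mon_degree (f i))"
  by (induction A rule: infinite_finite_induct) (simp_all add: mon_degree_add, simp_all add: mon_degree_def)

lemma mon_degree_single: "mon_degree (single v k) = k"
  by (simp add: mon_degree_def)

lemma mem_poly_component:
  "f \<in> poly_component V d \<longleftrightarrow>
    f \<in> carrier (poly_ring V) \<and> (\<forall>m\<in>keys f. mon_degree m = d)"
  by (simp add: poly_component_def)

lemma poly_component_0: "0 \<in> poly_component V d"
  by (simp add: mem_poly_component poly_ring_0)

lemma poly_component_add:
  "f \<in> poly_component V d \<Longrightarrow> g \<in> poly_component V d \<Longrightarrow> f + g \<in> poly_component V d"
  using keys_add [of f g] by (auto simp: mem_poly_component poly_ring_add)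

lemma poly_component_sum:
  "(\<And>i. i \<in> A \<Longrightarrow> f i \<in> poly_component V d) \<Longrightarrow> sum f A \<in> poly_component V d"
  by (induction A rule: infinite_finite_induct) (simp_all add: poly_component_0 poly_component_add)

lemma poly_component_uminus: "f \<in> poly_component V d \<Longrightarrow> - f \<in> poly_component V d"
  by (auto simp: mem_poly_component poly_ring_uminus)

lemma poly_component_mult:
  assumes "f \<in> poly_component V d" "g \<in> poly_component V e"
  shows "f * g \<in> poly_component V (d + e)"
proof -
  have "mon_degree m = d + e" if m: "m \<in> keys (f * g)" for m
  proof -
    obtain a b where "m = a + b" "a \<in> keys f" "b \<in> keys g"
      using subsetD [OF keys_mult m] by blast
    then show ?thesis
      using assms by (simp add: mem_poly_component mon_degree_add)
  qed
  then show ?thesis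
    using assms by (simp add: mem_poly_component poly_ring_mult)
qed

lemma poly_component_var: "v \<in> V \<Longrightarrow> var v \<in> poly_component V 1"
  by (simp add: mem_poly_component poly_ring_var) (simp add: var_def mon_degree_single)

definition homogeneous_part :: "nat \<Rightarrow> ('v, 'k::field) mpoly \<Rightarrow> ('v, 'k) mpoly" where
  "homogeneous_part d = Poly_Mapping.mapp (\<lambda>m a. if mon_degree m = d then a else 0)"

lemma lookup_homogeneous_part:
  "lookup (homogeneous_part d f) m = (if mon_degree m = d then lookup f m else 0)"
  by (simp add: homogeneous_part_def lookup_mapp when_def in_keys_iff)

lemma keys_homogeneous_part: "keys (homogeneous_part d f) = {m \<in> keys f. mon_degree m = d}"
  by (auto simp: in_keys_iff lookup_homogeneous_part split: if_splits)

lemma homogeneous_part_component: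
  "f \<in> carrier (poly_ring V) \<Longrightarrow> homogeneous_part d f \<in> poly_component V d"
  by (simp add: mem_poly_component carrier_poly_ring keys_homogeneous_part)

text \<open>A monomial can occur only in the component of its own degree, so its coefficient there
  must be its coefficient in \<open>f\<close>.\<close>

lemma homogeneous_decomposition_unique:
  assumes "\<And>d. c d \<in> poly_component V d" "finite {d. c d \<noteq> 0}" "f = (\<Sum>d\<in>{d. c d \<noteq> 0}. c d)"
  shows "c d = homogeneous_part d f"
proof (rule poly_mapping_eqI)
  fix m
  have other: "lookup (c e) m = 0" if "e \<noteq> mon_degree m" for e
    using assms(1) [of e] that by (auto simp: mem_poly_component in_keys_iff)
  have "lookup f m = (\<Sum>d\<in>{d. c d \<noteq> 0}. lookup (c d) m)"
    by (subst assms(3)) (simp add: lookup_sum)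
  also have "\<dots> = (\<Sum>d\<in>{d. c d \<noteq> 0}. if d = mon_degree m then lookup (c d) m else 0)"
    by (rule sum.cong) (use other in auto)
  also have "\<dots> = lookup (c (mon_degree m)) m"
    using assms(2) by simp
  finally show "lookup (c d) m = lookup (homogeneous_part d f) m"
    using other by (auto simp: lookup_homogeneous_part)
qed

lemma homogeneous_part_sum:
  "finite {d. homogeneous_part d f \<noteq> 0}"
  "f = (\<Sum>d\<in>{d. homogeneous_part d f \<noteq> 0}. homogeneous_part d f)"
proof -
  have "mon_degree ` keys f = {d. homogeneous_part d f \<noteq> 0}"
    by (auto simp: keys_homogeneous_part simp flip: keys_eq_empty)
  then show fin: "finite {d. homogeneous_part d f \<noteq> 0}"
    by (metis finite_imageI finite_keys)
  show "f = (\<Sum>d\<in>{d. homogeneous_part d f \<noteq> 0}. homogeneous_part d f)"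
  proof (rule poly_mapping_eqI)
    fix m
    have "lookup f m = 0" if "homogeneous_part (mon_degree m) f = 0"
      using that lookup_homogeneous_part [of "mon_degree m" f m] by simp
    then show "lookup f m = lookup (\<Sum>d\<in>{d. homogeneous_part d f \<noteq> 0}. homogeneous_part d f) m"
      using fin by (auto simp: lookup_sum lookup_homogeneous_part)
  qed
qed

text \<open>The grading is inherited from the polynomial ring: homogeneous parts are the only
  possible components, and the second assumption keeps them in \<open>H\<close>.\<close>

lemma graded_module_ideal:
  fixes H :: "('v, 'k::field) mpoly set"
  assumes H: "ideal H (poly_ring V)" and homogeneous: "\<And>d f. f \<in> H \<Longrightarrow> homogeneous_part d f \<in> H"
  shows "graded_module (poly_ring V) (poly_component V) (ideal_module (poly_ring V) H)
    (\<lambda>d. H \<inter> poly_component V d)"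
proof -
  note closed = poly_ring_ideal_closed [OF H]
  interpret M: module "poly_ring V" "ideal_module (poly_ring V) H"
    by (rule module_ideal_module [OF H])
  have minus: "\<ominus>\<^bsub>ideal_module (poly_ring V) H\<^esub> f = - f" if "f \<in> H" for f
    by (rule M.minus_equality) (use that closed in simp_all)
  have sub: "subgroup (H \<inter> poly_component V d) (add_monoid (ideal_module (poly_ring V) H))" for d
  proof
    fix f
    assume "f \<in> H \<inter> poly_component V d"
    then show "inv\<^bsub>add_monoid (ideal_module (poly_ring V) H)\<^esub> f \<in> H \<inter> poly_component V d"
      using minus [of f] by (auto simp: a_inv_def closed poly_component_uminus)
  qed (auto simp: closed poly_component_0 poly_component_add)
  have act: "a * f \<in> H \<inter> poly_component V (i + j)"
    if "a \<in> poly_component V i" "f \<in> H \<inter> poly_component V j" for a f i j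
    using that by (auto simp: poly_component_mult intro!: closed(4)) (simp add: mem_poly_component)
  have dec: "\<exists>!c. (\<forall>d. c d \<in> H \<inter> poly_component V d) \<and> finite {d. c d \<noteq> 0} \<and>
      f = finsum (ideal_module (poly_ring V) H) c {d. c d \<noteq> 0}" if "f \<in> H" for f
  proof (rule ex1I [of _ "\<lambda>d. homogeneous_part d f"])
    show "(\<forall>d. homogeneous_part d f \<in> H \<inter> poly_component V d) \<and>
        finite {d. homogeneous_part d f \<noteq> 0} \<and>
        f = finsum (ideal_module (poly_ring V) H) (\<lambda>d. homogeneous_part d f)
          {d. homogeneous_part d f \<noteq> 0}"
      using homogeneous [OF that] closed(5) [OF that] homogeneous_part_sum [of f]
      by (simp add: finsum_ideal_module [OF H] homogeneous_part_component)
  next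
    fix c
    assume c: "(\<forall>d. c d \<in> H \<inter> poly_component V d) \<and> finite {d. c d \<noteq> 0} \<and>
      f = finsum (ideal_module (poly_ring V) H) c {d. c d \<noteq> 0}"
    then have "f = (\<Sum>d\<in>{d. c d \<noteq> 0}. c d)"
      by (simp add: finsum_ideal_module [OF H])
    with c show "c = (\<lambda>d. homogeneous_part d f)"
      by (intro ext homogeneous_decomposition_unique [of c V f]) auto
  qed
  show ?thesis
    unfolding graded_module_def
  proof (intro conjI allI ballI)
    show "module (poly_ring V) (ideal_module (poly_ring V) H)"
      by (rule M.module_axioms)
    show "subgroup (H \<inter> poly_component V d) (add_monoid (ideal_module (poly_ring V) H))" for d
      by (rule sub)
    show "a \<odot>\<^bsub>ideal_module (poly_ring V) H\<^esub> f \<in> H \<inter> poly_component V (i + j)"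
      if "a \<in> poly_component V i" "f \<in> H \<inter> poly_component V j" for i j a f
      using act [OF that] by simp
  qed (use dec in simp_all)
qed

section \<open>Free modules\<close>

lemma free_module_simps [simp]:
  "zero (free_module R B) = 0" "add (free_module R B) = (+)"
  "smult (free_module R B) = (\<lambda>a. scale a)"
  by (simp_all add: free_module_def)

lemma mem_free_module:
  "v \<in> carrier (free_module R B) \<longleftrightarrow> keys v \<subseteq> B \<and> (\<forall>b. lookup v b \<in> carrier R)"
  by (simp add: free_module_def)

lemma free_module_lookup: "v \<in> carrier (free_module R B) \<Longrightarrow> lookup v b \<in> carrier R"
  unfolding mem_free_module by blast

lemma free_module_poly_0: "0 \<in> carrier (free_module (poly_ring V) B)"
  by (simp add: mem_free_module poly_ring_0)

lemma free_module_poly_add: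
  "v \<in> carrier (free_module (poly_ring V) B) \<Longrightarrow> w \<in> carrier (free_module (poly_ring V) B) \<Longrightarrow>
    v + w \<in> carrier (free_module (poly_ring V) B)"
  by (simp add: mem_free_module lookup_add poly_ring_add keys_add_subset)

lemma free_module_poly_sum:
  "(\<And>i. i \<in> A \<Longrightarrow> f i \<in> carrier (free_module (poly_ring V) B)) \<Longrightarrow>
    sum f A \<in> carrier (free_module (poly_ring V) B)"
  by (induction A rule: infinite_finite_induct)
    (simp_all add: free_module_poly_0 free_module_poly_add)

lemma free_module_poly_single:
  "b \<in> B \<Longrightarrow> a \<in> carrier (poly_ring V) \<Longrightarrow> single b a \<in> carrier (free_module (poly_ring V) B)"
  by (simp add: mem_free_module lookup_single when_def poly_ring_0)

lemma mem_free_component_const: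
  "v \<in> free_component (poly_ring V) (poly_component V) B (\<lambda>_. e) d \<longleftrightarrow>
    keys v \<subseteq> B \<and> (\<forall>b\<in>keys v. e \<le> d \<and> lookup v b \<in> poly_component V (d - e))"
  by (auto simp: free_component_def mem_free_module mem_poly_component)
    (metis in_keys_iff poly_ring_0)

lemma free_component_add:
  fixes v w :: "'b \<Rightarrow>\<^sub>0 ('v, 'k::field) mpoly"
  assumes "v \<in> free_component (poly_ring V) (poly_component V) B (\<lambda>_. e) d"
    and "w \<in> free_component (poly_ring V) (poly_component V) B (\<lambda>_. e) d"
  shows "v + w \<in> free_component (poly_ring V) (poly_component V) B (\<lambda>_. e) d"
proof -
  \<comment> \<open>At indices outside \<open>keys u\<close> the coefficient is 0, which lies in
    every component; so the sum can be treated index by index.\<close>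
  have comp: "lookup u b \<in> poly_component V (d - e)"
    if "u \<in> free_component (poly_ring V) (poly_component V) B (\<lambda>_. e) d"
    for u :: "'b \<Rightarrow>\<^sub>0 ('v, 'k) mpoly" and b
    using that poly_component_0 by (cases "b \<in> keys u") (auto simp: mem_free_component_const in_keys_iff)
  show ?thesis
    unfolding mem_free_component_const
  proof (intro conjI ballI)
    show "keys (v + w) \<subseteq> B"
      using assms by (intro keys_add_subset) (auto simp: mem_free_component_const)
    fix b
    assume "b \<in> keys (v + w)"
    then have "b \<in> keys v \<or> b \<in> keys w"
      using keys_add [of v w] by auto
    then show "e \<le> d"
      using assms by (auto simp: mem_free_component_const)
    show "lookup (v + w) b \<in> poly_component V (d - e)"
      using comp assms by (simp add: lookup_add poly_component_add)
  qed
qed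

text \<open>One closure principle for three properties of a boundary: lying in the free module, in a
  graded component, and in the irrelevant ideal times the module. The signs are absorbed into
  \<open>a\<close>, and the variable stands first so that it can act as a scalar.\<close>

lemma e_boundary_extension_closed:
  fixes v :: "'p set \<times> 'p set \<Rightarrow>\<^sub>0 ('p xyvar, 'k::field) mpoly"
  assumes zero: "Q 0" and add: "\<And>x y. Q x \<Longrightarrow> Q y \<Longrightarrow> Q (x + y)"
    and X: "\<And>I T p a. (I, T) \<in> keys v \<Longrightarrow> p \<in> I \<inter> T \<Longrightarrow> a \<in> {lookup v (I, T), - lookup v (I, T)} \<Longrightarrow>
      Q (single (I - {p}, T) (var (X p) * a))"
    and Y: "\<And>I T p a. (I, T) \<in> keys v \<Longrightarrow> p \<in> I \<inter> T \<Longrightarrow> a \<in> {lookup v (I, T), - lookup v (I, T)} \<Longrightarrow>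
      Q (single (I, T - {p}) (var (Y p) * a))"
  shows "Q (linear_extension (e_boundary s) v)"
proof -
  have sum: "Q (sum f A)" if "\<And>i. i \<in> A \<Longrightarrow> Q (f i)" for f and A :: "'x set"
    using that by (induction A rule: infinite_finite_induct) (simp_all add: zero add)
  have "Q (scale (lookup v (I, T)) (e_boundary s (I, T)))" if b: "(I, T) \<in> keys v" for I T
  proof -
    have "scale (lookup v (I, T)) (e_boundary s (I, T)) = (\<Sum>p\<in>I \<inter> T.
        single (I - {p}, T) (var (X p) * ((-1) ^ position s (I \<inter> T) p * lookup v (I, T))) +
        single (I, T - {p}) (var (Y p) * (- ((-1) ^ position s (I \<inter> T) p) * lookup v (I, T))))"
      by (simp only: e_boundary_def prod.case scale_sum scale_diff scale_single)
        (simp add: single_uminus mult_ac)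
    also have "Q \<dots>"
    proof (rule sum)
      fix p
      assume p: "p \<in> I \<inter> T"
      have "(-1) ^ position s (I \<inter> T) p = (1 :: ('p xyvar, 'k) mpoly) \<or>
          (-1) ^ position s (I \<inter> T) p = (-1 :: ('p xyvar, 'k) mpoly)"
        by (simp add: minus_one_power_iff)
      then show "Q (single (I - {p}, T) (var (X p) * ((-1) ^ position s (I \<inter> T) p * lookup v (I, T))) +
          single (I, T - {p}) (var (Y p) * (- ((-1) ^ position s (I \<inter> T) p) * lookup v (I, T))))"
        by (intro add X [OF b p] Y [OF b p]) auto
    qed
    finally show ?thesis .
  qed
  then show ?thesis
    unfolding linear_extension_def by (intro sum) auto
qed

section \<open>The resolution\<close>

context ordered_finite_poset
begin

abbreviation S :: "('p xyvar, 'k::field) mpoly ring" where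
  "S \<equiv> poly_ring (xy_vars P)"

abbreviation F :: "nat \<Rightarrow> (('p xyvar, 'k::field) mpoly, 'p set \<times> 'p set \<Rightarrow>\<^sub>0 ('p xyvar, 'k) mpoly) module"
where
  "F i \<equiv> free_module S (e_basis P r i)"

abbreviation d :: "('p set \<times> 'p set \<Rightarrow>\<^sub>0 ('p xyvar, 'k::field) mpoly) \<Rightarrow>
    ('p set \<times> 'p set \<Rightarrow>\<^sub>0 ('p xyvar, 'k) mpoly)" where
  "d \<equiv> linear_extension (e_boundary s)"

text \<open>On the basis of \<open>F 0\<close> the second component is the complement of the first,
  so \<open>fst b\<close> carries all the information.\<close>

abbreviation augmentation :: "('p set \<times> 'p set \<Rightarrow>\<^sub>0 ('p xyvar, 'k::field) mpoly) \<Rightarrow> ('p xyvar, 'k) mpoly"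
where
  "augmentation \<equiv> linear_form (\<lambda>b. u_monomial P (fst b))"

section \<open>Exactness over the polynomial ring\<close>

lemma d_assemble_sum:
  assumes "\<And>m. m \<in> \<M> \<Longrightarrow> keys (c m) \<subseteq> strand_cells m i"
  shows "d (\<Sum>m\<in>\<M>. assemble m (c m)) =
    (\<Sum>m\<in>\<M>. assemble m (linear_extension (cube_boundary s) (c m)))"
  by (simp add: linear_extension_sum boundary_assemble [OF assms])

lemma augmentation_assemble_sum:
  assumes "\<And>m. m \<in> \<M> \<Longrightarrow> keys (c m) \<subseteq> strand_cells m 0"
  shows "augmentation (\<Sum>m\<in>\<M>. assemble m (c m)) = (\<Sum>m\<in>\<M>. single m (linear_form (\<lambda>_. 1) (c m)))"
  by (simp add: linear_form_sum augmentation_assemble [OF assms])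

lemma d_d:
  assumes "v \<in> carrier (F (Suc i) :: (_, _ \<Rightarrow>\<^sub>0 ('p xyvar, 'k::field) mpoly) module)"
  shows "d (d v) = 0"
proof -
  obtain \<M> c where v: "finite \<M>" "\<forall>m\<in>\<M>. keys m \<subseteq> xy_vars P"
    "\<forall>m\<in>\<M>. keys (c m) \<subseteq> strand_cells m (Suc i)"
    "v = (\<Sum>m\<in>\<M>. assemble m (c m))"
    by (rule strand_decomposition [OF assms])
  have keys: "keys (linear_extension (cube_boundary s) (c m)) \<subseteq> strand_cells m i" if "m \<in> \<M>" for m
    using bspec [OF v(3) that] by (rule keys_extension_boundary)
  have "linear_extension (cube_boundary s) (linear_extension (cube_boundary s) (c m)) = 0"
    if "m \<in> \<M>" for m
    using bspec [OF v(3) that]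
    by (intro cube_boundary_boundary_extension [of _ "Suc i"]) (auto simp: cells_def)
  then show ?thesis
    by (simp add: v(4) d_assemble_sum [OF bspec [OF v(3)]] d_assemble_sum [OF keys] assemble_0)
qed

lemma augmentation_d:
  assumes "v \<in> carrier (F 1 :: (_, _ \<Rightarrow>\<^sub>0 ('p xyvar, 'k::field) mpoly) module)"
  shows "augmentation (d v) = 0"
proof -
  obtain \<M> c where v: "finite \<M>" "\<forall>m\<in>\<M>. keys m \<subseteq> xy_vars P"
    "\<forall>m\<in>\<M>. keys (c m) \<subseteq> strand_cells m 1"
    "v = (\<Sum>m\<in>\<M>. assemble m (c m))"
    by (rule strand_decomposition [OF assms])
  have keys: "keys (linear_extension (cube_boundary s) (c m)) \<subseteq> strand_cells m 0" if "m \<in> \<M>" for m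
    using bspec [OF v(3) that] unfolding One_nat_def by (rule keys_extension_boundary)
  show ?thesis
    by (simp add: v(4) d_assemble_sum [OF bspec [OF v(3)]] augmentation_assemble_sum [OF keys]
        linear_form_cube_boundary_extension)
qed

text \<open>Preimages are chosen multidegree by multidegree and then assembled; the first assumption
  keeps the result over the variables of \<open>P\<close>.\<close>

lemma lift_strand_preimages:
  fixes c :: "_ \<Rightarrow> (_ \<Rightarrow>\<^sub>0 'k::field)"
  assumes "\<And>m. m \<in> \<M> \<Longrightarrow> keys m \<subseteq> xy_vars P"
    and "\<And>m. m \<in> \<M> \<Longrightarrow>
      \<exists>w. keys w \<subseteq> strand_cells m (Suc i) \<and> linear_extension (cube_boundary s) w = c m"
  shows "(\<Sum>m\<in>\<M>. assemble m (c m)) \<in> d ` carrier (F (Suc i))"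
proof -
  obtain w where w: "\<And>m. m \<in> \<M> \<Longrightarrow> keys (w m) \<subseteq> strand_cells m (Suc i)"
    "\<And>m. m \<in> \<M> \<Longrightarrow> linear_extension (cube_boundary s) (w m) = c m"
    using assms(2) by metis
  have "(\<Sum>m\<in>\<M>. assemble m (c m)) = d (\<Sum>m\<in>\<M>. assemble m (w m))"
    by (simp add: d_assemble_sum [OF w(1)] w(2))
  moreover have "(\<Sum>m\<in>\<M>. assemble m (w m)) \<in> carrier (F (Suc i))"
    by (intro free_module_poly_sum assemble_in_free_module assms(1) w(1))
  ultimately show ?thesis
    by (rule image_eqI)
qed

lemma exact_Suc:
  assumes "v \<in> carrier (F (Suc i) :: (_, _ \<Rightarrow>\<^sub>0 ('p xyvar, 'k::field) mpoly) module)" "d v = 0"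
  shows "v \<in> d ` carrier (F (Suc (Suc i)))"
proof -
  obtain \<M> c where v: "finite \<M>" "\<forall>m\<in>\<M>. keys m \<subseteq> xy_vars P"
    "\<forall>m\<in>\<M>. keys (c m) \<subseteq> strand_cells m (Suc i)"
    "v = (\<Sum>m\<in>\<M>. assemble m (c m))"
    by (rule strand_decomposition [OF assms(1)])
  have keys: "keys (linear_extension (cube_boundary s) (c m)) \<subseteq> strand_cells m i" if "m \<in> \<M>" for m
    using bspec [OF v(3) that] by (rule keys_extension_boundary)
  have "(\<Sum>m\<in>\<M>. assemble m (linear_extension (cube_boundary s) (c m))) = 0"
    using assms(2) by (simp add: v(4) d_assemble_sum [OF bspec [OF v(3)]])
  \<comment> \<open>The equation \<open>d v = 0\<close> splits into one equation for each
    multidegree.\<close>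
  from assemble_independent [OF v(1) this keys]
  have "linear_extension (cube_boundary s) (c m) = 0" if "m \<in> \<M>" for m
    using that by blast
  with v show ?thesis
    by (auto intro!: lift_strand_preimages strand_exact)
qed

lemma exact_0:
  assumes "v \<in> carrier (F 0 :: (_, _ \<Rightarrow>\<^sub>0 ('p xyvar, 'k::field) mpoly) module)" "augmentation v = 0"
  shows "v \<in> d ` carrier (F 1)"
proof -
  obtain \<M> c where v: "finite \<M>" "\<forall>m\<in>\<M>. keys m \<subseteq> xy_vars P"
    "\<forall>m\<in>\<M>. keys (c m) \<subseteq> strand_cells m 0"
    "v = (\<Sum>m\<in>\<M>. assemble m (c m))"
    by (rule strand_decomposition [OF assms(1)])
  have "(\<Sum>m\<in>\<M>. single m (linear_form (\<lambda>_. 1) (c m))) = 0"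
    using assms(2) by (simp add: v(4) augmentation_assemble_sum [OF bspec [OF v(3)]])
  \<comment> \<open>Distinct monomials are independent, so the coefficients of every strand sum to
    zero separately.\<close>
  from single_independent [OF v(1) this]
  have "\<exists>w. keys w \<subseteq> strand_cells m (Suc 0) \<and> linear_extension (cube_boundary s) w = c m"
    if "m \<in> \<M>" for m
    using strand_exact_0 [OF bspec [OF v(3)]] that by simp
  with v show ?thesis
    unfolding One_nat_def by (auto intro!: lift_strand_preimages)
qed

section \<open>The monomial ideal and the augmentation onto it\<close>

lemma u_monomial_component:
  assumes "I \<in> poset_ideals P r"
  shows "u_monomial P I \<in> poly_component (xy_vars P) (card P)"
proof -
  have "I \<subseteq> P"
    using assms by (simp add: poset_ideals_def)
  then have "keys (cell_exponent (I, P - I)) \<subseteq> xy_vars P"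
    unfolding cell_exponent_def xy_vars_def by (intro keys_add_subset keys_sum_subset) auto
  moreover have "mon_degree (cell_exponent (I, P - I)) = card P"
    using \<open>I \<subseteq> P\<close> finite_subset_P [OF \<open>I \<subseteq> P\<close>] card_mono [OF finite_P \<open>I \<subseteq> P\<close>]
    by (simp add: cell_exponent_def mon_degree_add mon_degree_sum mon_degree_single card_Diff_subset)
  ultimately show ?thesis
    by (simp add: u_monomial_eq_single mem_poly_component carrier_poly_ring)
qed

lemma ideal_H_ideal: "ideal (H_ideal P r) (S :: ('p xyvar, 'k::field) mpoly ring)"
  unfolding H_ideal_def
  by (rule poly_ring.genideal_ideal) (use u_monomial_component in \<open>auto simp: mem_poly_component\<close>)

lemma u_monomial_in_H_ideal:
  "I \<in> poset_ideals P r \<Longrightarrow> u_monomial P I \<in> (H_ideal P r :: ('p xyvar, 'k::field) mpoly set)"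
  unfolding H_ideal_def
  by (rule subsetD [OF poly_ring.genideal_self])
    (use u_monomial_component in \<open>auto simp: mem_poly_component\<close>)

text \<open>Multiplication only enlarges supports, so the right-hand side describes an ideal, and it
  contains the generators; conversely, a monomial with such supports is a multiple of the squarefree
  \<open>u\<^sub>I\<close>. Deciding membership monomial by monomial is what homogeneity and
  surjectivity rest on.\<close>

lemma mem_H_ideal_iff:
  "f \<in> H_ideal P r \<longleftrightarrow> f \<in> carrier S \<and>
    (\<forall>m\<in>keys f. \<exists>I\<in>poset_ideals P r. I \<subseteq> x_support m \<and> P - I \<subseteq> y_support m)"
  for f :: "('p xyvar, 'k::field) mpoly"
proof -
  let ?H = "{f :: ('p xyvar, 'k) mpoly. f \<in> carrier S \<and>
    (\<forall>m\<in>keys f. \<exists>I\<in>poset_ideals P r. I \<subseteq> x_support m \<and> P - I \<subseteq> y_support m)}"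
  have support_mono: "x_support m \<subseteq> x_support (n + m)" "y_support m \<subseteq> y_support (n + m)"
    for m n :: "'p xyvar \<Rightarrow>\<^sub>0 nat"
    by (auto simp: x_support_def y_support_def lookup_add)
  have mult: "a * f \<in> ?H" if a: "a \<in> carrier S" and f: "f \<in> ?H" for a f
  proof -
    have "\<exists>I\<in>poset_ideals P r. I \<subseteq> x_support m \<and> P - I \<subseteq> y_support m" if m: "m \<in> keys (a * f)" for m
    proof -
      obtain k l where kl: "m = k + l" "l \<in> keys f"
        using subsetD [OF keys_mult m] by blast
      then obtain I where I: "I \<in> poset_ideals P r" "I \<subseteq> x_support l" "P - I \<subseteq> y_support l"
        using f by blast
      show ?thesis
        unfolding kl(1)
        using I(1) order_trans [OF I(2) support_mono(1)] order_trans [OF I(3) support_mono(2)]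
        by (intro bexI [of _ I] conjI)
    qed
    then show ?thesis
      using a f by (simp add: poly_ring_mult)
  qed
  have add: "f + g \<in> ?H" if f: "f \<in> ?H" and g: "g \<in> ?H" for f g
  proof -
    have "f + g \<in> carrier S"
      using f g by (simp add: poly_ring_add)
    moreover have "m \<in> keys f \<or> m \<in> keys g" if "m \<in> keys (f + g)" for m
      using subsetD [OF keys_add that] by blast
    ultimately show ?thesis
      using f g by blast
  qed
  have uminus: "- f \<in> ?H" if "f \<in> ?H" for f
    using that by (simp add: poly_ring_uminus)
  have "ideal ?H (S :: ('p xyvar, 'k) mpoly ring)"
  proof (rule idealI [OF poly_ring.ring_axioms])
    show "subgroup ?H (add_monoid (S :: ('p xyvar, 'k) mpoly ring))"
    proof (rule subgroup.intro)
      fix f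
      assume f: "f \<in> ?H"
      then have "inv\<^bsub>add_monoid S\<^esub> f = - f"
        using poly_ring_a_inv [of f "xy_vars P"] unfolding a_inv_def by blast
      with uminus [OF f] show "inv\<^bsub>add_monoid S\<^esub> f \<in> ?H"
        by (simp only:)
    next
      fix f g
      assume "f \<in> ?H" "g \<in> ?H"
      from add [OF this] show "f \<otimes>\<^bsub>add_monoid S\<^esub> g \<in> ?H"
        by simp
    qed (auto simp: poly_ring_0)
  next
    fix f a
    assume "f \<in> ?H" "a \<in> carrier (S :: ('p xyvar, 'k) mpoly ring)"
    from mult [OF this(2,1)] show "a \<otimes>\<^bsub>S\<^esub> f \<in> ?H" "f \<otimes>\<^bsub>S\<^esub> a \<in> ?H"
      by (simp_all only: poly_ring_simps mult.commute [of f a])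
  qed
  moreover have "u_monomial P I \<in> ?H" if "I \<in> poset_ideals P r" for I
  proof -
    have "I \<subseteq> P"
      using that by (simp add: poset_ideals_def)
    then have "I \<subseteq> x_support (cell_exponent (I, P - I))" "P - I \<subseteq> y_support (cell_exponent (I, P - I))"
      using support_add_cell_exponent [of "(I, P - I)" 0] finite_P finite_subset_P by auto
    then show ?thesis
      using u_monomial_component [OF that, where ?'a = 'k] that
      by (auto simp: mem_poly_component) (auto simp: u_monomial_eq_single)
  qed
  ultimately have "H_ideal P r \<subseteq> ?H"
    unfolding H_ideal_def by (intro poly_ring.genideal_minimal) auto
  moreover have "f \<in> H_ideal P r" if f: "f \<in> ?H" for f
  proof -
    have "single m (lookup f m) \<in> H_ideal P r" if m: "m \<in> keys f" for m
    proof -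
      obtain I where I: "I \<in> poset_ideals P r" "I \<subseteq> x_support m" "P - I \<subseteq> y_support m"
        using f m by blast
      have "I \<subseteq> P"
        using I(1) by (simp add: poset_ideals_def)
      then have "m - cell_exponent (I, P - I) + cell_exponent (I, P - I) = m"
        using I finite_P finite_subset_P by (intro cell_exponent_divides) auto
      then have "single m (lookup f m) = single (m - cell_exponent (I, P - I)) (lookup f m) * u_monomial P I"
        by (simp add: u_monomial_eq_single mult_single)
      moreover have "keys m \<subseteq> xy_vars P"
        using f m by (simp add: carrier_poly_ring)
      then have "keys (m - cell_exponent (I, P - I)) \<subseteq> xy_vars P"
        by (auto simp: in_keys_iff lookup_minus subset_iff)
      then have "single (m - cell_exponent (I, P - I)) (lookup f m) \<in> carrier S"
        by (simp add: carrier_poly_ring)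
      ultimately show ?thesis
        using poly_ring_ideal_closed(4) [OF ideal_H_ideal] u_monomial_in_H_ideal [OF I(1)] by metis
    qed
    then show ?thesis
      by (subst poly_mapping_eq_sum_single) (rule poly_ring_ideal_sum [OF ideal_H_ideal])
  qed
  ultimately show ?thesis
    by blast
qed

lemma graded_module_H_ideal:
  "graded_module (S :: ('p xyvar, 'k::field) mpoly ring) (poly_component (xy_vars P))
    (ideal_module S (H_ideal P r)) (H_component P r)"
proof -
  \<comment> \<open>The criterion concerns single monomials, and a homogeneous part has no monomials
    beyond those of \<open>f\<close>.\<close>
  have "homogeneous_part d f \<in> H_ideal P r" if "f \<in> H_ideal P r" for d and f :: "('p xyvar, 'k) mpoly"
    using that by (auto simp: mem_H_ideal_iff carrier_poly_ring keys_homogeneous_part)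
  from graded_module_ideal [OF ideal_H_ideal this] show ?thesis
    by (simp add: H_component_def [abs_def])
qed

lemma augmentation_in_H_ideal:
  assumes "v \<in> carrier (F 0)"
  shows "augmentation v \<in> H_ideal P r"
  unfolding linear_form_def
proof (rule poly_ring_ideal_sum [OF ideal_H_ideal], rule poly_ring_ideal_closed(4) [OF ideal_H_ideal])
  fix b
  assume "b \<in> keys v"
  then have "b \<in> e_basis P r 0"
    using assms by (auto simp: mem_free_module)
  then show "u_monomial P (fst b) \<in> H_ideal P r"
    by (auto intro!: u_monomial_in_H_ideal simp: e_basis_def)
  show "lookup v b \<in> carrier S"
    using assms by (rule free_module_lookup)
qed

text \<open>For each monomial \<open>m\<close> of \<open>f\<close> one \<open>I\<close> with
  \<open>u\<^sub>I\<close> dividing \<open>m\<close> is chosen; the vertex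
  \<open>(I, P - I)\<close>, weighted by the coefficient of \<open>m\<close> and assembled in
  multidegree \<open>m\<close>, maps to that term of \<open>f\<close>.\<close>

lemma augmentation_surjective:
  assumes "f \<in> H_ideal P r"
  shows "f \<in> augmentation ` carrier (F 0)"
proof -
  have f: "f \<in> carrier S"
    "\<forall>m\<in>keys f. \<exists>I. I \<in> poset_ideals P r \<and> I \<subseteq> x_support m \<and> P - I \<subseteq> y_support m"
    using assms mem_H_ideal_iff [of f] by auto
  obtain I where I: "\<And>m. m \<in> keys f \<Longrightarrow>
      I m \<in> poset_ideals P r \<and> I m \<subseteq> x_support m \<and> P - I m \<subseteq> y_support m"
    using f(2) by metis
  define c where "c m = single (I m, P - I m) (lookup f m)" for m
  have c: "keys (c m) \<subseteq> strand_cells m 0" if "m \<in> keys f" for m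
    using I [OF that] by (auto simp: c_def mem_cells_iff poset_ideals_def)
  have "f = augmentation (\<Sum>m\<in>keys f. assemble m (c m))"
    by (simp only: augmentation_assemble_sum [OF c])
      (simp add: c_def linear_form_single flip: poly_mapping_eq_sum_single)
  moreover have "(\<Sum>m\<in>keys f. assemble m (c m)) \<in> carrier (F 0)"
    using f(1) by (intro free_module_poly_sum assemble_in_free_module c) (auto simp: carrier_poly_ring)
  ultimately show ?thesis
    by (rule image_eqI)
qed

lemma augmentation_graded_hom:
  "augmentation \<in> graded_homs S (F 0) (free_component S (poly_component (xy_vars P)) (e_basis P r 0)
      (\<lambda>_. card P)) (ideal_module S (H_ideal P r)) (H_component P r)"
proof -
  have "augmentation v \<in> H_component P r d"
    if v: "v \<in> free_component S (poly_component (xy_vars P)) (e_basis P r 0) (\<lambda>_. card P) d" for v d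
  proof -
    have "lookup v b * u_monomial P (fst b) \<in> poly_component (xy_vars P) d" if b: "b \<in> keys v" for b
    proof -
      have "b \<in> e_basis P r 0" "card P \<le> d" "lookup v b \<in> poly_component (xy_vars P) (d - card P)"
        using v b by (auto simp: mem_free_component_const)
      then have "u_monomial P (fst b) \<in> poly_component (xy_vars P) (card P)"
        by (auto intro!: u_monomial_component simp: e_basis_def)
      from poly_component_mult [OF \<open>lookup v b \<in> _\<close> this] show ?thesis
        using \<open>card P \<le> d\<close> by simp
    qed
    then have "augmentation v \<in> poly_component (xy_vars P) d"
      unfolding linear_form_def by (rule poly_component_sum)
    then show ?thesis
      using augmentation_in_H_ideal [of v] v by (simp add: H_component_def free_component_def)
  qed
  then show ?thesis
    unfolding graded_homs_def module_homs_def
    by (auto simp: augmentation_in_H_ideal linear_form_add linear_form_scale)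
qed

section \<open>Degrees and minimality of the differential\<close>

lemma facets:
  assumes "keys v \<subseteq> e_basis P r (Suc i)" "(I, T) \<in> keys v" "p \<in> I \<inter> T"
  shows "(I - {p}, T) \<in> e_basis P r i" "(I, T - {p}) \<in> e_basis P r i" "X p \<in> xy_vars P" "Y p \<in> xy_vars P"
proof -
  have IT: "(I, T) \<in> e_basis P r (Suc i)"
    using assms by blast
  then show "(I - {p}, T) \<in> e_basis P r i" "(I, T - {p}) \<in> e_basis P r i"
    using assms(3) by (rule e_basis_facets)+
  have "p \<in> P"
    using IT assms(3) by (auto simp: mem_e_basis_iff)
  then show "X p \<in> xy_vars P" "Y p \<in> xy_vars P"
    by (simp_all add: xy_vars_def)
qed

lemma d_carrier:
  assumes "v \<in> carrier (F (Suc i))"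
  shows "d v \<in> carrier (F i)"
proof -
  have keys: "keys v \<subseteq> e_basis P r (Suc i)"
    using assms by (simp add: mem_free_module)
  have single: "single b (var x * a) \<in> carrier (F i)"
    if "b \<in> e_basis P r i" "x \<in> xy_vars P" "a \<in> {lookup v (I, T), - lookup v (I, T)}" for b x a I T
    using that free_module_lookup [OF assms]
    by (intro free_module_poly_single poly_ring_mult poly_ring_var) (auto intro: poly_ring_uminus)
  show ?thesis
  proof (rule e_boundary_extension_closed)
    show "x + y \<in> carrier (F i)" if "x \<in> carrier (F i)" "y \<in> carrier (F i)" for x y
      using that by (rule free_module_poly_add)
    show "single (I - {p}, T) (var (X p) * a) \<in> carrier (F i)"
      if "(I, T) \<in> keys v" "p \<in> I \<inter> T" "a \<in> {lookup v (I, T), - lookup v (I, T)}" for I T p a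
      by (rule single [OF facets(1) [OF keys that(1,2)] facets(3) [OF keys that(1,2)] that(3)])
    show "single (I, T - {p}) (var (Y p) * a) \<in> carrier (F i)"
      if "(I, T) \<in> keys v" "p \<in> I \<inter> T" "a \<in> {lookup v (I, T), - lookup v (I, T)}" for I T p a
      by (rule single [OF facets(2) [OF keys that(1,2)] facets(4) [OF keys that(1,2)] that(3)])
  qed (rule free_module_poly_0)
qed

lemma d_component:
  assumes "v \<in> free_component S (poly_component (xy_vars P)) (e_basis P r (Suc i)) (\<lambda>_. card P + Suc i) e"
  shows "d v \<in> free_component S (poly_component (xy_vars P)) (e_basis P r i) (\<lambda>_. card P + i) e"
    (is "_ \<in> ?C")
proof -
  have keys: "keys v \<subseteq> e_basis P r (Suc i)"
    using assms by (simp add: mem_free_component_const)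
  have single: "single b (var x * a) \<in> ?C"
    if b: "(I, T) \<in> keys v" "b \<in> e_basis P r i" "x \<in> xy_vars P"
      and a: "a \<in> {lookup v (I, T), - lookup v (I, T)}" for b x a I T
  proof -
    have "card P + Suc i \<le> e" "a \<in> poly_component (xy_vars P) (e - (card P + Suc i))"
      using assms b(1) a by (auto simp: mem_free_component_const poly_component_uminus)
    \<comment> \<open>The degree 1 of the variable makes up for the drop of the basis degree by one;
      the bound on \<open>e\<close> keeps the subtraction exact.\<close>
    moreover from poly_component_mult [OF poly_component_var [OF b(3)] this(2)]
    have "var x * a \<in> poly_component (xy_vars P) (e - (card P + i))"
      using \<open>card P + Suc i \<le> e\<close> by (simp add: Suc_diff_Suc)
    ultimately show ?thesis
      using b(2) by (simp add: mem_free_component_const)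
  qed
  show ?thesis
  proof (rule e_boundary_extension_closed)
    show "0 \<in> ?C"
      by (simp add: mem_free_component_const)
    show "x + y \<in> ?C" if "x \<in> ?C" "y \<in> ?C" for x y
      using that by (rule free_component_add)
    show "single (I - {p}, T) (var (X p) * a) \<in> ?C"
      if "(I, T) \<in> keys v" "p \<in> I \<inter> T" "a \<in> {lookup v (I, T), - lookup v (I, T)}" for I T p a
      by (rule single [OF that(1) facets(1) [OF keys that(1,2)] facets(3) [OF keys that(1,2)] that(3)])
    show "single (I, T - {p}) (var (Y p) * a) \<in> ?C"
      if "(I, T) \<in> keys v" "p \<in> I \<inter> T" "a \<in> {lookup v (I, T), - lookup v (I, T)}" for I T p a
      by (rule single [OF that(1) facets(2) [OF keys that(1,2)] facets(4) [OF keys that(1,2)] that(3)])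
  qed
qed

text \<open>All nonzero entries of the matrix of \<partial> are variables up to sign, hence of
  degree 1 and in the irrelevant ideal.\<close>

lemma d_minimal:
  assumes "v \<in> carrier (F (Suc i))"
  shows "d v \<in> ideal_times_module (irrelevant_ideal S (poly_component (xy_vars P))) (F i)"
    (is "_ \<in> ?M")
proof -
  have keys: "keys v \<subseteq> e_basis P r (Suc i)" and coeff: "lookup v b \<in> carrier S" for b
    using assms by (simp add: mem_free_module, rule free_module_lookup)
  have var: "var x \<in> irrelevant_ideal S (poly_component (xy_vars P))" if "x \<in> xy_vars P" for x
  proof -
    have "(\<Union>d\<in>{1..}. poly_component (xy_vars P) d) \<subseteq> carrier S"
      by (auto simp: mem_poly_component)
    from subsetD [OF poly_ring.genideal_self [OF this]] show ?thesis
      using poly_component_var [OF that] unfolding irrelevant_ideal_def by force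
  qed
  have single: "single b (var x * a) \<in> ?M"
    if "(I, T) \<in> keys v" "b \<in> e_basis P r i" "x \<in> xy_vars P"
      and a: "a \<in> {lookup v (I, T), - lookup v (I, T)}" for b x a I T
  proof -
    have "a \<in> carrier S"
      using a coeff poly_ring_uminus by auto
    then have "single b a \<in> carrier (F i)"
      using that by (intro free_module_poly_single)
    moreover have "single b (var x * a) = var x \<odot>\<^bsub>F i\<^esub> single b a"
      by simp
    ultimately show ?thesis
      unfolding ideal_times_module_def using var that by (intro generate.incl) blast
  qed
  show ?thesis
  proof (rule e_boundary_extension_closed)
    show "0 \<in> ?M"
      unfolding ideal_times_module_def using generate.one [of "add_monoid (F i)"] by simp
    show "x + y \<in> ?M" if "x \<in> ?M" "y \<in> ?M" for x y
      using that generate.eng [of _ "add_monoid (F i)"] unfolding ideal_times_module_def by simp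
    show "single (I - {p}, T) (var (X p) * a) \<in> ?M"
      if "(I, T) \<in> keys v" "p \<in> I \<inter> T" "a \<in> {lookup v (I, T), - lookup v (I, T)}" for I T p a
      by (rule single [OF that(1) facets(1) [OF keys that(1,2)] facets(3) [OF keys that(1,2)] that(3)])
    show "single (I, T - {p}) (var (Y p) * a) \<in> ?M"
      if "(I, T) \<in> keys v" "p \<in> I \<inter> T" "a \<in> {lookup v (I, T), - lookup v (I, T)}" for I T p a
      by (rule single [OF that(1) facets(2) [OF keys that(1,2)] facets(4) [OF keys that(1,2)] that(3)])
  qed
qed

lemma d_graded_hom:
  "d \<in> graded_homs S (F (Suc i))
    (free_component S (poly_component (xy_vars P)) (e_basis P r (Suc i)) (\<lambda>_. card P + Suc i)) (F i)
    (free_component S (poly_component (xy_vars P)) (e_basis P r i) (\<lambda>_. card P + i))"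
  unfolding graded_homs_def module_homs_def
  using d_carrier d_component by (auto simp: linear_extension_add linear_extension_scale)

lemma graded_minimal_free_resolution_H_ideal:
  "graded_minimal_free_resolution (S :: ('p xyvar, 'k::field) mpoly ring)
     (poly_component (xy_vars P)) (e_basis P r) (\<lambda>i _. card P + i) (\<lambda>_. d)
     (ideal_module S (H_ideal P r)) (H_component P r)"
  unfolding graded_minimal_free_resolution_def Let_def
proof (intro conjI allI)
  show "\<exists>\<epsilon>\<in>graded_homs S (F 0) (free_component S (poly_component (xy_vars P)) (e_basis P r 0)
        (\<lambda>_. card P + 0)) (ideal_module S (H_ideal P r)) (H_component P r).
      \<epsilon> ` carrier (F 0) = carrier (ideal_module S (H_ideal P r)) \<and>
      {v \<in> carrier (F 0). \<epsilon> v = \<zero>\<^bsub>ideal_module S (H_ideal P r)\<^esub>} =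
        (d :: _ \<Rightarrow> _ \<Rightarrow>\<^sub>0 ('p xyvar, 'k) mpoly) ` carrier (F 1)"
  proof (rule bexI [of _ augmentation], intro conjI)
    show "augmentation ` carrier (F 0) = carrier (ideal_module S (H_ideal P r))"
      using augmentation_in_H_ideal augmentation_surjective by auto
    show "{v \<in> carrier (F 0). augmentation v = \<zero>\<^bsub>ideal_module S (H_ideal P r)\<^esub>} =
        (d :: _ \<Rightarrow> _ \<Rightarrow>\<^sub>0 ('p xyvar, 'k) mpoly) ` carrier (F 1)"
      using exact_0 augmentation_d d_carrier [of _ 0] by auto
  qed (use augmentation_graded_hom in simp)
  show "{v \<in> carrier (F (Suc i)). d v = \<zero>\<^bsub>F i\<^esub>} =
      (d :: _ \<Rightarrow> _ \<Rightarrow>\<^sub>0 ('p xyvar, 'k) mpoly) ` carrier (F (Suc (Suc i)))" for i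
    using exact_Suc [of _ i] d_d [of _ "Suc i"] d_carrier [of _ "Suc i"] by auto
  show "(d :: _ \<Rightarrow> _ \<Rightarrow>\<^sub>0 ('p xyvar, 'k) mpoly) ` carrier (F (Suc i)) \<subseteq>
      ideal_times_module (irrelevant_ideal S (poly_component (xy_vars P))) (F i)" for i
    using d_minimal by auto
qed (use graded_module_H_ideal finite_e_basis d_graded_hom in auto)

end

theorem theorem2p1:
  fixes P :: "'p set" and r s :: "'p rel"
  assumes "finite P" and "partial_order_on P r"
    and "linear_order_on P s" and "r \<subseteq> s"
  shows "graded_minimal_free_resolution
           (poly_ring (xy_vars P) :: ('p xyvar, 'k::field) mpoly ring)
           (poly_component (xy_vars P))
           (e_basis P r) (\<lambda>i _. card P + i) (\<lambda>_. linear_extension (e_boundary s))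
           (ideal_module (poly_ring (xy_vars P)) (H_ideal P r)) (H_component P r)"
proof -
  interpret ordered_finite_poset P r s
    using assms by unfold_locales
  show ?thesis
    by (rule graded_minimal_free_resolution_H_ideal)
qed

end
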